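(* For every integer $d\ge 4$ there exists an infinite family of pairwise combinatorially distinct inscribed $d$-dimensional polytopes $P_n$, $n\ge 1$, where $P_n$ has $12(n+1)+d-4$ vertices and $\dim\mathcal{RS}(P_n)\le 76+d(d+1)$ for all $n\ge1$.
   Context: A polytope is inscribed if all its vertices lie on a common sphere. For a $d$-polytope $P$ with labelled vertices, the realization space $\mathcal{RS}(P)$ is the semialgebraic set of all labelled vertex tuples $V\in(S^d)^{f_0(P)}$ such that $\mathrm{conv}(V)$ is combinatorially equivalent to $P$ via a face-lattice isomorphism respecting the labelling; its dimension is well defined. *)

theory Defs
  imports "HOL-Analysis.Analysis"
begin

section \<open>Semialgebraic sets and their dimension\<close>

text \<open>For a finite index set \<open>J\<close>, the space $\mathbb{R}^J$ is \<open>J \<rightarrow>\<^sub>E UNIV\<close>. The topology on it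
  is induced by the product topology of the library on functions; for finite \<open>J\<close> this is the
  Euclidean topology.\<close>

inductive real_poly_fun :: "'j set \<Rightarrow> (('j \<Rightarrow> real) \<Rightarrow> real) \<Rightarrow> bool" for J where
  const: "real_poly_fun J (\<lambda>x. c)"
| coord: "j \<in> J \<Longrightarrow> real_poly_fun J (\<lambda>x. x j)"
| add: "real_poly_fun J p \<Longrightarrow> real_poly_fun J q \<Longrightarrow> real_poly_fun J (\<lambda>x. p x + q x)"
| mult: "real_poly_fun J p \<Longrightarrow> real_poly_fun J q \<Longrightarrow> real_poly_fun J (\<lambda>x. p x * q x)"

inductive semialgebraic :: "'j set \<Rightarrow> ('j \<Rightarrow> real) set \<Rightarrow> bool" for J where
  pos: "real_poly_fun J p \<Longrightarrow> semialgebraic J {x \<in> J \<rightarrow>\<^sub>E UNIV. p x > 0}"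
| compl: "semialgebraic J A \<Longrightarrow> semialgebraic J ((J \<rightarrow>\<^sub>E UNIV) - A)"
| inter: "semialgebraic J A \<Longrightarrow> semialgebraic J B \<Longrightarrow> semialgebraic J (A \<inter> B)"

text \<open>A map is semialgebraic if its graph is; \<open>case_sum x y\<close> is the point $(x,y)$ of
  $\mathbb{R}^I \times \mathbb{R}^J = \mathbb{R}^{I \sqcup J}$.\<close>

definition semialgebraic_map ::
    "'i set \<Rightarrow> 'j set \<Rightarrow> ('i \<Rightarrow> real) set \<Rightarrow> (('i \<Rightarrow> real) \<Rightarrow> ('j \<Rightarrow> real)) \<Rightarrow> bool" where
  "semialgebraic_map I J A f \<longleftrightarrow> semialgebraic (I <+> J) ((\<lambda>x. case_sum x (f x)) ` A)"

definition open_cube :: "nat \<Rightarrow> (nat \<Rightarrow> real) set" where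
  "open_cube k = {..<k} \<rightarrow>\<^sub>E {0<..<1}"

definition contains_open_cell :: "'j set \<Rightarrow> ('j \<Rightarrow> real) set \<Rightarrow> nat \<Rightarrow> bool" where
  "contains_open_cell J A k \<longleftrightarrow>
     (\<exists>f g. f ` open_cube k \<subseteq> A \<and> homeomorphism (open_cube k) (f ` open_cube k) f g \<and>
            semialgebraic_map {..<k} J (open_cube k) f)"

text \<open>The dimension of a semialgebraic set is the largest dimension of a cell (a subset
  semialgebraically homeomorphic to an open cube) contained in it. It is extended-real valued so
  that the empty set gets dimension $-\infty$ and the supremum is meaningful without a proof of
  boundedness.\<close>

definition semialgebraic_dim :: "'j set \<Rightarrow> ('j \<Rightarrow> real) set \<Rightarrow> ereal" where
  "semialgebraic_dim J A = (SUP k \<in> {k. contains_open_cell J A k}. ereal (real k))"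

section \<open>Polytopes and combinatorial equivalence\<close>

definition vertices :: "'a::euclidean_space set \<Rightarrow> 'a set" where
  "vertices P = {v. v extreme_point_of P}"

definition inscribed :: "'a::euclidean_space set \<Rightarrow> bool" where
  "inscribed P \<longleftrightarrow> (\<exists>c r. r > 0 \<and> vertices P \<subseteq> sphere c r)"

definition faces :: "'a::euclidean_space set \<Rightarrow> 'a set set" where
  "faces P = {F. F face_of P}"

definition lattice_iso :: "('a set \<Rightarrow> 'b set) \<Rightarrow> 'a set set \<Rightarrow> 'b set set \<Rightarrow> bool" where
  "lattice_iso \<phi> L M \<longleftrightarrow>
     bij_betw \<phi> L M \<and> (\<forall>F\<in>L. \<forall>G\<in>L. F \<subseteq> G \<longleftrightarrow> \<phi> F \<subseteq> \<phi> G)"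

definition comb_equiv :: "'a::euclidean_space set \<Rightarrow> 'b::euclidean_space set \<Rightarrow> bool" where
  "comb_equiv P Q \<longleftrightarrow> (\<exists>\<phi>. lattice_iso \<phi> (faces P) (faces Q))"

section \<open>Spherical polytopes and realization spaces\<close>

text \<open>A spherical polytope is the spherical convex hull of finitely many points of the unit sphere
  that lie in a common open hemisphere. Its faces, including the empty one and the polytope itself
  (\<open>a = 0\<close>), are cut out by the closed hemispheres containing it.\<close>

definition in_open_hemisphere :: "'a::euclidean_space set \<Rightarrow> bool" where
  "in_open_hemisphere S \<longleftrightarrow> S \<subseteq> sphere 0 1 \<and> (\<exists>a. \<forall>x\<in>S. a \<bullet> x > 0)"

definition spherical_hull :: "'a::euclidean_space set \<Rightarrow> 'a set" where
  "spherical_hull S = sphere 0 1 \<inter> conic hull (convex hull S)"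

definition spherical_faces :: "'a::euclidean_space set \<Rightarrow> 'a set set" where
  "spherical_faces Q = {Q \<inter> {x. a \<bullet> x = 0} | a. \<forall>x\<in>Q. a \<bullet> x \<ge> 0}"

text \<open>For a \<open>d\<close>-polytope \<open>P\<close> in the \<open>d\<close>-dimensional space \<open>'a\<close>, the sphere $S^d$ is the unit sphere
  of \<open>'a \<times> real\<close>. The vertices of \<open>P\<close> serve as their own labels, so a labelled vertex tuple is a
  function on \<open>vertices P\<close>.\<close>

definition realization_space :: "'a::euclidean_space set \<Rightarrow> ('a \<Rightarrow> 'a \<times> real) set" where
  "realization_space P =
     {V \<in> vertices P \<rightarrow>\<^sub>E sphere 0 1.
        in_open_hemisphere (V ` vertices P) \<and>
        (\<exists>\<phi>. lattice_iso \<phi> (faces P) (spherical_faces (spherical_hull (V ` vertices P))) \<and>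
             (\<forall>v\<in>vertices P. \<phi> {v} = {V v}))}"

definition tuple_coords ::
    "'i set \<Rightarrow> ('i \<Rightarrow> 'b::euclidean_space) \<Rightarrow> ('i \<times> 'b \<Rightarrow> real)" where
  "tuple_coords I V = (\<lambda>(i, b) \<in> I \<times> Basis. V i \<bullet> b)"

definition dim_RS :: "'a::euclidean_space set \<Rightarrow> ereal" where
  "dim_RS P = semialgebraic_dim (vertices P \<times> Basis)
                (tuple_coords (vertices P) ` realization_space P)"

end

theory Submission
  imports Defs "HOL-Homology.Homology"
begin

text \<open>
  The complement of a great circle in the unit sphere of $\mathbb{R}^4$ is conformally
  $\mathbb{H}^2 \times S^1$. Take a regular hyperbolic quadrilateral with sides of length
  $\mathrm{arcosh}\,2$, extend its sides to geodesics, and mark on each of them, starting from the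
  midpoint of the side, points at distance $\mathrm{arcosh}\,2$ in one direction. Placing three
  points of $S^1$ over each marked point, alternately the even and the odd sixth roots of unity, gives
  layers of 12 points on the sphere. They form a quotient of the layers $x + y + z = i$ of the cubical
  lattice $\mathbb{Z}^3$: steps along a geodesic with rotation by $\pm\pi/3$ are the first two unit
  vectors, and the reflection at the corner of the quadrilateral from one geodesic to the
  preceding one is the third. Every lattice cube whose lowest layer is at least $-1$ spans a
  supporting hyperplane of the convex hull of the layers $0, \dots, n$, so the lattice squares are
  2-faces.

  In any realization the three squares below a vertex $w$ span planes meeting only in $w$, and each
  plane is spanned by vertices of the two preceding layers. Hence the 24 vertices of the layers 0
  and 1 determine a realization, which leaves at most $4 \cdot 24$ parameters. Iterated
  pyramids with the remaining basis vectors as apexes give the result for $d > 4$.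
\<close>

section \<open>Face lattices of polytopes\<close>

text \<open>The constants are matched so that a cube functional is, up to a positive factor, a
  hyperbolic term minus \<open>2 * cos\<close>. On the two geodesics carrying the cube the
  hyperbolic term takes the values 1, 2, 7, 26, ...; twice the cosine of a multiple of
  \<open>pi / 3\<close> is at most 2, and at most 1 for an odd multiple. Alternating the roots of
  unity makes the multiple odd wherever the hyperbolic term is 1, so the difference is never
  negative. Squares are cut out by two neighbouring cubes, which also removes a stray contact of the
  cubes with lowest layer -1.

  The bound is \<open>5 * d + 19 * 4 + (d - 4) * d\<close>: in every realization the base spans a
  linear space of dimension 5, already spanned by the 24 seed points. Five of them, forming a basis,
  move on the d-sphere, the other 19 on a 4-sphere, and the \<open>d - 4\<close> apexes again on the
  d-sphere.

  Linear spans determine a vertex only up to sign, and dimension is defined by cells. The count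
  therefore becomes a bound through local charts, small enough to exclude antipodes, and invariance
  of domain.\<close>

lemma lattice_isoD:
  assumes "lattice_iso \<phi> L M"
  shows "F \<in> L \<Longrightarrow> \<phi> F \<in> M"
    and "F \<in> L \<Longrightarrow> G \<in> L \<Longrightarrow> \<phi> F \<subseteq> \<phi> G \<longleftrightarrow> F \<subseteq> G"
    and "H \<in> M \<Longrightarrow> \<exists>F\<in>L. \<phi> F = H"
  using assms by (auto simp: lattice_iso_def bij_betw_def)

text \<open>\<open>facet_of\<close> excludes the empty face. A single point, whose face of
  codimension one is empty, is treated apart so that inductions on dimension can descend to
  \<open>{}\<close>.\<close>

lemma polytope_face_subset_codim1:
  fixes S :: "'a::euclidean_space set"
  assumes S: "polytope S" and C: "C face_of S" "C \<noteq> S"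
  obtains G where "G face_of S" "C \<subseteq> G" "aff_dim G = aff_dim S - 1"
proof (cases "C = {}")
  case True
  then have "S \<noteq> {}" using C by simp
  then obtain v where v: "v extreme_point_of S"
    using S extreme_point_exists_convex polytope_imp_compact polytope_imp_convex by blast
  show thesis
  proof (cases "S = {v}")
    case True
    then show thesis using that[of "{}"] \<open>C = {}\<close> by simp
  next
    case False
    have "{v} face_of S" using v by (simp add: face_of_singleton)
    then obtain F where "F facet_of S" "{v} \<subseteq> F"
      using face_of_polyhedron_subset_facet[OF polytope_imp_polyhedron[OF S], of "{v}"] False by auto
    then show thesis using that[of F] True by (auto simp: facet_of_def)
  qed
next
  case False
  then obtain F where "F facet_of S" "C \<subseteq> F"
    using face_of_polyhedron_subset_facet[OF polytope_imp_polyhedron[OF S] C(1)] C(2) by auto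
  then show thesis using that[of F] by (auto simp: facet_of_def)
qed

lemma lattice_iso_faces_empty:
  assumes "lattice_iso \<phi> (faces P) (faces Q)"
  shows "\<phi> {} = {}"
proof -
  have "{} \<in> faces P" "{} \<in> faces Q" by (auto simp: faces_def)
  then show ?thesis using lattice_isoD[OF assms] by (metis empty_subsetI subset_empty)
qed

text \<open>Dimension is rank in the face lattice: a face of codimension one in
  \<open>\<phi> F\<close> above \<open>\<phi> G\<close> has a preimage between \<open>G\<close> and
  \<open>F\<close>, which can only be \<open>G\<close>. The induction measure is shifted by one
  because the empty face has dimension -1.\<close>

lemma lattice_iso_aff_dim:
  fixes P :: "'a::euclidean_space set" and Q :: "'b::euclidean_space set"
  assumes P: "polytope P" and Q: "polytope Q" and iso: "lattice_iso \<phi> (faces P) (faces Q)"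
    and F: "F face_of P"
  shows "aff_dim (\<phi> F) = aff_dim F"
  using F
proof (induction "nat (aff_dim F + 1)" arbitrary: F rule: less_induct)
  case less
  note D = lattice_isoD[OF iso, unfolded faces_def mem_Collect_eq]
  show ?case
  proof (cases "F = {}")
    case True
    then show ?thesis using lattice_iso_faces_empty[OF iso] by simp
  next
    case False
    have pF: "polytope F" using less.prems P face_of_polytope_polytope by blast
    obtain G where G: "G face_of F" "aff_dim G = aff_dim F - 1"
      using polytope_face_subset_codim1[OF pF, of "{}"] False by (metis empty_face_of)
    have GP: "G face_of P" using G less.prems face_of_trans by blast
    have "aff_dim F \<ge> 0" using False
      by (metis aff_dim_negative_iff not_less)
    then have IH: "aff_dim (\<phi> G) = aff_dim F - 1"
      using less.hyps[OF _ GP] G by auto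
    have GF: "G \<subseteq> F" "G \<noteq> F" using G face_of_imp_subset by fastforce+
    have fG: "\<phi> G face_of Q" and fF: "\<phi> F face_of Q" using D(1) GP less.prems by auto
    have sub: "\<phi> G \<subseteq> \<phi> F" "\<not> \<phi> F \<subseteq> \<phi> G" using D(2) GP less.prems GF by auto
    have "\<phi> G face_of \<phi> F" using face_of_subset[OF fG sub(1)] fF face_of_imp_subset by blast
    then obtain H where H: "H face_of \<phi> F" "\<phi> G \<subseteq> H" "aff_dim H = aff_dim (\<phi> F) - 1"
      using polytope_face_subset_codim1[of "\<phi> F" "\<phi> G"] face_of_polytope_polytope[OF Q fF] sub by blast
    then have "H face_of Q" using fF face_of_trans by blast
    then obtain H0 where H0: "H0 face_of P" "\<phi> H0 = H" using D(3) by blast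
    have "G \<subseteq> H0" using D(2)[OF GP H0(1)] H0(2) H(2) by auto
    moreover have "H0 \<subseteq> F" using D(2)[OF H0(1) less.prems] H0(2) face_of_imp_subset[OF H(1)] by simp
    moreover have "H0 \<noteq> F" using H H0(2) by auto
    ultimately have "H0 face_of F" "G face_of H0"
      using H0(1) GP less.prems by (meson face_of_imp_subset face_of_subset)+
    then have "G = H0"
      using face_of_aff_dim_lt[of F H0] face_of_aff_dim_lt[of H0 G] \<open>H0 \<noteq> F\<close> G(2)
        less.prems H0(1) face_of_imp_convex by fastforce
    then show ?thesis using H H0 IH by auto
  qed
qed

text \<open>Vertices are the faces of dimension 0. This will tell the members of the family
  apart.\<close>

lemma comb_equiv_card_vertices:
  fixes P :: "'a::euclidean_space set" and Q :: "'b::euclidean_space set"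
  assumes P: "polytope P" and Q: "polytope Q" and "comb_equiv P Q"
  shows "card (vertices P) = card (vertices Q)"
proof -
  obtain \<phi> where iso: "lattice_iso \<phi> (faces P) (faces Q)"
    using assms by (auto simp: comb_equiv_def)
  note D = lattice_isoD[OF iso, unfolded faces_def mem_Collect_eq]
  have points: "(\<lambda>v. {v}) ` vertices S = {F. F face_of S \<and> aff_dim F = 0}"
    for S :: "'c::euclidean_space set"
    by (auto simp: vertices_def face_of_singleton aff_dim_eq_0)
  have "bij_betw \<phi> {F. F face_of P \<and> aff_dim F = 0} {F. F face_of Q \<and> aff_dim F = 0}"
  proof (rule bij_betw_imageI)
    show "inj_on \<phi> {F. F face_of P \<and> aff_dim F = 0}"
      using iso by (auto simp: lattice_iso_def bij_betw_def faces_def intro: inj_on_subset)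
    show "\<phi> ` {F. F face_of P \<and> aff_dim F = 0} = {F. F face_of Q \<and> aff_dim F = 0}"
      using D(1) lattice_iso_aff_dim[OF P Q iso] D(3) by (auto simp: image_iff) metis
  qed
  then have "card ((\<lambda>v. {v}) ` vertices P) = card ((\<lambda>v. {v}) ` vertices Q)"
    unfolding points by (rule bij_betw_same_card)
  then show ?thesis by (simp add: card_image)
qed

lemma lattice_iso_inv_comp:
  assumes f: "lattice_iso f K M" and g: "lattice_iso g L M"
  shows "lattice_iso (inv_into L g \<circ> f) K L"
    and "F \<in> K \<Longrightarrow> g ((inv_into L g \<circ> f) F) = f F"
proof -
  have bf: "bij_betw f K M" and bg: "bij_betw g L M"
    using f g by (auto simp: lattice_iso_def)
  have eq: "g ((inv_into L g \<circ> f) F) = f F" if "F \<in> K" for F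
    using that bf bg by (simp add: bij_betw_apply bij_betw_inv_into_right)
  then show "F \<in> K \<Longrightarrow> g ((inv_into L g \<circ> f) F) = f F" .
  have b: "bij_betw (inv_into L g \<circ> f) K L"
    using bij_betw_trans[OF bf bij_betw_inv_into[OF bg]] .
  have "F \<subseteq> G \<longleftrightarrow> (inv_into L g \<circ> f) F \<subseteq> (inv_into L g \<circ> f) G" if "F \<in> K" "G \<in> K" for F G
    using lattice_isoD(2)[OF g bij_betw_apply[OF b that(1)] bij_betw_apply[OF b that(2)]]
      lattice_isoD(2)[OF f that] eq that by simp
  with b show "lattice_iso (inv_into L g \<circ> f) K L"
    by (simp add: lattice_iso_def)
qed

text \<open>A face of the hull of a finite set is the hull of some of its points, and among these
  only \<open>T\<close> lies on the hyperplane. The second claim later yields the vertex sets of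
  faces.\<close>

lemma supporting_functional_face:
  fixes S :: "'a::euclidean_space set"
  assumes fin: "finite S" and nonneg: "\<And>x. x \<in> S \<Longrightarrow> a \<bullet> x + \<beta> \<ge> 0"
    and zero: "\<And>x. x \<in> S \<Longrightarrow> a \<bullet> x + \<beta> = 0 \<longleftrightarrow> x \<in> T" and "T \<subseteq> S"
  shows "convex hull T face_of convex hull S" "S \<inter> convex hull T = T"
proof -
  have "S \<subseteq> {x. a \<bullet> x \<ge> - \<beta>}" using nonneg by force
  then have "convex hull S \<subseteq> {x. a \<bullet> x \<ge> - \<beta>}" by (rule hull_minimal) (rule convex_halfspace_ge)
  then have "convex hull S \<inter> {x. a \<bullet> x = - \<beta>} face_of convex hull S"
    by (intro face_of_Int_supporting_hyperplane_ge) auto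
  moreover have sub: "convex hull T \<subseteq> convex hull S \<inter> {x. a \<bullet> x = - \<beta>}"
  proof -
    have "T \<subseteq> {x. a \<bullet> x = - \<beta>}" using zero \<open>T \<subseteq> S\<close> by force
    then have "convex hull T \<subseteq> {x. a \<bullet> x = - \<beta>}" by (rule hull_minimal) (rule convex_hyperplane)
    then show ?thesis using hull_mono[OF \<open>T \<subseteq> S\<close>, of convex] by blast
  qed
  moreover have "convex hull S \<inter> {x. a \<bullet> x = - \<beta>} \<subseteq> convex hull T"
  proof -
    obtain S' where S': "S' \<subseteq> S" "convex hull S \<inter> {x. a \<bullet> x = - \<beta>} = convex hull S'"
      using calculation(1) by (rule face_of_convex_hull_subset[OF finite_imp_compact[OF fin]])
    have "S' \<subseteq> T"
    proof
      fix x assume x: "x \<in> S'"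
      then have "x \<in> convex hull S \<inter> {x. a \<bullet> x = - \<beta>}" unfolding S'(2) by (rule hull_inc)
      then show "x \<in> T" using zero[of x] x S'(1) by auto
    qed
    then show ?thesis unfolding S'(2) by (rule hull_mono)
  qed
  ultimately show "convex hull T face_of convex hull S" by (metis subset_antisym)
  show "S \<inter> convex hull T = T"
    using sub zero hull_subset[of T convex] \<open>T \<subseteq> S\<close> by fastforce
qed

text \<open>The ball is strictly convex: the open segment between two of its points stays off the
  sphere.\<close>

lemma vertices_convex_hull_sphere:
  fixes S :: "'a::euclidean_space set"
  assumes "S \<subseteq> sphere 0 1"
  shows "vertices (convex hull S) = S"
proof
  show "vertices (convex hull S) \<subseteq> S" by (auto simp: vertices_def dest: extreme_point_of_convex_hull)
  have ball: "convex hull S \<subseteq> cball 0 1" using assms by (intro hull_minimal) auto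
  show "S \<subseteq> vertices (convex hull S)"
  proof
    fix x assume x: "x \<in> S"
    have "x \<notin> open_segment y z" if "y \<in> convex hull S" "z \<in> convex hull S" for y z
    proof
      assume "x \<in> open_segment y z"
      then have "norm x < max (norm y) (norm z) \<or> norm x < 1"
        using dist_decreases_open_segment[of x y z 0] by (auto simp: dist_norm)
      moreover have "norm y \<le> 1" "norm z \<le> 1" "norm x = 1" using that ball x assms by auto
      ultimately show False by auto
    qed
    then show "x \<in> vertices (convex hull S)" using x by (simp add: vertices_def extreme_point_of_def hull_inc)
  qed
qed

lemma aff_dim_four_points_le_2:
  fixes p :: "'a::euclidean_space"
  assumes "p = u *\<^sub>R x + v *\<^sub>R y + w *\<^sub>R z" "u + v + w = 1"
  shows "aff_dim {p, x, y, z} \<le> 2"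
proof -
  have "p \<in> affine hull {x, y, z}" using assms by (auto simp: affine_hull_3)
  then have "aff_dim {p, x, y, z} = aff_dim {x, y, z}" by (simp add: aff_dim_insert)
  also have "\<dots> \<le> int (card {x, y, z}) - 1" by (rule aff_dim_le_card) simp
  also have "card {x, y, z} \<le> 3" by (simp add: card_insert_if)
  finally show ?thesis by simp
qed

lemma aff_dim_Un_finite_le:
  fixes A :: "'a::euclidean_space set"
  assumes "finite B"
  shows "aff_dim (A \<union> B) \<le> aff_dim A + int (card B)"
  using assms by induction (auto simp: aff_dim_insert)

section \<open>Spherical polytopes through their gnomonic projection\<close>

text \<open>Central projection onto the affine hyperplane \<open>a \<bullet> x = 1\<close>, where a
  spherical polytope in the open hemisphere around \<open>a\<close> becomes a Euclidean one.\<close>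

definition gnomonic :: "'a::euclidean_space \<Rightarrow> 'a \<Rightarrow> 'a" where
  "gnomonic a x = x /\<^sub>R (a \<bullet> x)"

text \<open>Central projection preserves segments: weights rescaled by the heights
  \<open>a \<bullet> x\<close> and \<open>a \<bullet> y\<close> express the projected combination as
  a convex combination of projections.\<close>

lemma convex_gnomonic_vimage:
  fixes a :: "'a::euclidean_space"
  assumes "convex T"
  shows "convex {x. a \<bullet> x > 0 \<and> gnomonic a x \<in> T}"
proof (rule convexI, safe)
  fix x y and u v :: real
  assume A: "0 \<le> u" "0 \<le> v" "u + v = 1" "a \<bullet> x > 0" "a \<bullet> y > 0"
    "gnomonic a x \<in> T" "gnomonic a y \<in> T"
  let ?s = "u * (a \<bullet> x) + v * (a \<bullet> y)"
  have s: "?s > 0" using A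
    by (smt (verit) mult_nonneg_nonneg mult_pos_pos)
  then show "a \<bullet> (u *\<^sub>R x + v *\<^sub>R y) > 0" by (simp add: inner_add_right)
  have "(u * (a \<bullet> x) / ?s) *\<^sub>R gnomonic a x + (v * (a \<bullet> y) / ?s) *\<^sub>R gnomonic a y \<in> T"
    using A s by (intro convexD[OF assms]) (auto simp flip: add_divide_distrib)
  also have "(u * (a \<bullet> x) / ?s) *\<^sub>R gnomonic a x + (v * (a \<bullet> y) / ?s) *\<^sub>R gnomonic a y
      = gnomonic a (u *\<^sub>R x + v *\<^sub>R y)"
    using A(4,5) by (simp add: gnomonic_def inner_add_right scaleR_add_right divide_inverse_commute mult.assoc)
  finally show "gnomonic a (u *\<^sub>R x + v *\<^sub>R y) \<in> T" .
qed

lemma convex_positive_multiples: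
  fixes T :: "'a::real_vector set"
  assumes "convex T"
  shows "convex {x. \<exists>c>0. c *\<^sub>R x \<in> T}"
proof (rule convexI, safe)
  fix x y and u v c e :: real
  assume A: "0 \<le> u" "0 \<le> v" "u + v = 1" "c > 0" "e > 0" "c *\<^sub>R x \<in> T" "e *\<^sub>R y \<in> T"
  let ?s = "u / c + v / e"
  have s: "?s > 0" using A
    by (smt (verit) divide_nonneg_pos divide_pos_pos)
  have "(u / c / ?s) *\<^sub>R (c *\<^sub>R x) + (v / e / ?s) *\<^sub>R (e *\<^sub>R y) \<in> T"
    using A s by (intro convexD[OF assms]) (auto simp flip: add_divide_distrib simp del: divide_divide_eq_left)
  also have "(u / c / ?s) *\<^sub>R (c *\<^sub>R x) + (v / e / ?s) *\<^sub>R (e *\<^sub>R y) = (1 / ?s) *\<^sub>R (u *\<^sub>R x + v *\<^sub>R y)"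
    using A(4,5) by (simp add: scaleR_add_right)
  finally show "\<exists>c>0. c *\<^sub>R (u *\<^sub>R x + v *\<^sub>R y) \<in> T"
    using s by (intro exI[of _ "1 / ?s"]) auto
qed

context
  fixes S :: "'a::euclidean_space set" and a :: 'a
  assumes fin: "finite S" and sph: "S \<subseteq> sphere 0 1" and pos: "\<And>x. x \<in> S \<Longrightarrow> a \<bullet> x > 0"
begin

lemma gnomonic_hull_hyperplane:
  assumes "x \<in> convex hull (gnomonic a ` S)"
  shows "a \<bullet> x = 1"
proof -
  have "gnomonic a ` S \<subseteq> {x. a \<bullet> x = 1}" using pos by (force simp: gnomonic_def)
  then have "convex hull (gnomonic a ` S) \<subseteq> {x. a \<bullet> x = 1}"
    by (rule hull_minimal) (rule convex_hyperplane)
  then show ?thesis using assms by auto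
qed

lemma sgn_gnomonic_hull: "sgn ` (convex hull (gnomonic a ` S)) = spherical_hull S"
proof (intro equalityI subsetI)
  fix y assume "y \<in> sgn ` (convex hull (gnomonic a ` S))"
  then obtain x where x: "x \<in> convex hull (gnomonic a ` S)" "y = sgn x" by auto
  have "x \<noteq> 0" using gnomonic_hull_hyperplane[OF x(1)] by auto
  have "gnomonic a ` S \<subseteq> {x. \<exists>c>0. c *\<^sub>R x \<in> convex hull S}"
  proof safe
    fix x assume "x \<in> S"
    then show "\<exists>c>0. c *\<^sub>R gnomonic a x \<in> convex hull S"
      using pos[of x] by (intro exI[of _ "a \<bullet> x"]) (simp add: gnomonic_def hull_inc)
  qed
  then have "convex hull (gnomonic a ` S) \<subseteq> {x. \<exists>c>0. c *\<^sub>R x \<in> convex hull S}"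
    by (rule hull_minimal) (simp add: convex_positive_multiples)
  then obtain c where c: "c > 0" "c *\<^sub>R x \<in> convex hull S" using x by auto
  have "y = (inverse (norm x) / c) *\<^sub>R (c *\<^sub>R x)" using c x by (simp add: sgn_div_norm)
  then have "y \<in> conic hull (convex hull S)"
    unfolding conic_hull_explicit using c by (auto intro!: exI[of _ "inverse (norm x) / c"] exI[of _ "c *\<^sub>R x"])
  then show "y \<in> spherical_hull S"
    using x \<open>x \<noteq> 0\<close> by (simp add: spherical_hull_def norm_sgn)
next
  fix y assume "y \<in> spherical_hull S"
  then obtain c x where y: "norm y = 1" "y = c *\<^sub>R x" "c \<ge> 0" "x \<in> convex hull S"
    by (auto simp: spherical_hull_def conic_hull_explicit)
  have "S \<subseteq> {x. a \<bullet> x > 0 \<and> gnomonic a x \<in> convex hull (gnomonic a ` S)}"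
    using pos by (auto simp: hull_inc)
  then have "convex hull S \<subseteq> {x. a \<bullet> x > 0 \<and> gnomonic a x \<in> convex hull (gnomonic a ` S)}"
    by (rule hull_minimal) (simp add: convex_gnomonic_vimage)
  then have x: "a \<bullet> x > 0" "gnomonic a x \<in> convex hull (gnomonic a ` S)" using y by auto
  have "c > 0" using y by (cases "c = 0") auto
  have "sgn (gnomonic a x) = sgn x" "sgn y = sgn x"
    using x \<open>c > 0\<close> y(2) by (simp_all add: gnomonic_def sgn_scaleR)
  moreover have "sgn y = y" using y by (simp add: sgn_div_norm)
  ultimately show "y \<in> sgn ` (convex hull (gnomonic a ` S))" using x by (metis imageI)
qed

text \<open>On the hyperplane, \<open>a \<bullet> sgn x\<close> is the reciprocal of
  \<open>norm x\<close>, so the direction determines the length.\<close>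

lemma inj_on_sgn_gnomonic_hull: "inj_on sgn (convex hull (gnomonic a ` S))"
proof
  fix x y assume xy: "x \<in> convex hull (gnomonic a ` S)" "y \<in> convex hull (gnomonic a ` S)" "sgn x = sgn y"
  have a: "a \<bullet> x = 1" "a \<bullet> y = 1" using xy gnomonic_hull_hyperplane by auto
  have "inverse (norm x) = a \<bullet> sgn x" "inverse (norm y) = a \<bullet> sgn y"
    using a by (simp_all add: sgn_div_norm)
  then have "norm x = norm y" using xy by (metis inverse_inverse_eq)
  moreover have "z = norm z *\<^sub>R sgn z" for z :: 'a by (cases "z = 0") (simp_all add: sgn_div_norm)
  ultimately show "x = y" using xy(3) by metis
qed

lemma spherical_faces_gnomonic:
  "spherical_faces (spherical_hull S) = image sgn ` faces (convex hull (gnomonic a ` S))"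
proof -
  let ?P = "convex hull (gnomonic a ` S)"
  have poly: "polyhedron ?P"
    using fin by (simp add: polytope_convex_hull polytope_imp_polyhedron)
  have ne: "x \<noteq> 0" if "x \<in> ?P" for x using gnomonic_hull_hyperplane[OF that] by auto
  have cut: "sgn ` (?P \<inter> {x. c \<bullet> x = 0}) = spherical_hull S \<inter> {x. c \<bullet> x = 0}" for c
    unfolding sgn_gnomonic_hull[symmetric] using ne by (auto simp: sgn_div_norm)
  have sup: "(\<forall>x\<in>spherical_hull S. c \<bullet> x \<ge> 0) \<longleftrightarrow> (\<forall>x\<in>?P. c \<bullet> x \<ge> 0)" for c
    unfolding sgn_gnomonic_hull[symmetric] using ne
    by (auto simp: sgn_div_norm zero_le_mult_iff)
  show ?thesis
  proof (intro equalityI subsetI)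
    fix G assume "G \<in> spherical_faces (spherical_hull S)"
    then obtain c where c: "\<forall>x\<in>?P. c \<bullet> x \<ge> 0" "G = sgn ` (?P \<inter> {x. c \<bullet> x = 0})"
      by (auto simp: spherical_faces_def sup cut)
    then have "?P \<inter> {x. c \<bullet> x = 0} face_of ?P"
      by (intro face_of_Int_supporting_hyperplane_ge) auto
    then show "G \<in> image sgn ` faces ?P" using c by (auto simp: faces_def)
  next
    fix G assume "G \<in> image sgn ` faces ?P"
    then obtain F where F: "F face_of ?P" "G = sgn ` F" by (auto simp: faces_def)
    then obtain c b where c: "?P \<subseteq> {x. c \<bullet> x \<le> b}" "F = ?P \<inter> {x. c \<bullet> x = b}"
      using exposed_face_of_polyhedron[OF poly, of F] unfolding exposed_face_of_def by blast
    \<comment> \<open>On the polytope \<open>a \<bullet> x = 1\<close>, which homogenizes the affine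
      inequality \<open>c \<bullet> x \<le> b\<close>.\<close>
    let ?c = "b *\<^sub>R a - c"
    have in1: "?c \<bullet> x = b - c \<bullet> x" if "x \<in> ?P" for x
      using gnomonic_hull_hyperplane[OF that] by (simp add: inner_diff_left)
    have "F = ?P \<inter> {x. ?c \<bullet> x = 0}" using c(2) in1 by auto
    moreover have "\<forall>x\<in>?P. ?c \<bullet> x \<ge> 0" using c(1) in1 by auto
    ultimately show "G \<in> spherical_faces (spherical_hull S)"
      unfolding spherical_faces_def F(2) using cut sup by blast
  qed
qed

lemma lattice_iso_sgn_gnomonic:
  "lattice_iso (image sgn) (faces (convex hull (gnomonic a ` S))) (spherical_faces (spherical_hull S))"
proof -
  have sub: "F \<subseteq> convex hull (gnomonic a ` S)" if "F \<in> faces (convex hull (gnomonic a ` S))" for F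
    using that face_of_imp_subset by (auto simp: faces_def)
  show ?thesis
    unfolding lattice_iso_def spherical_faces_gnomonic
    using sub inj_on_image_subset_iff[OF inj_on_sgn_gnomonic_hull] inj_on_image_eq_iff[OF inj_on_sgn_gnomonic_hull]
    by (auto simp: bij_betw_def inj_on_def)
qed

end

section \<open>Linear algebra of realizations\<close>

text \<open>The hyperplane misses the origin, so adjoining 0 raises the affine dimension by one and
  keeps the span.\<close>

lemma aff_dim_eq_dim_hyperplane:
  fixes T :: "'a::euclidean_space set"
  assumes "\<And>x. x \<in> T \<Longrightarrow> a \<bullet> x = 1"
  shows "aff_dim T + 1 = int (dim T)"
proof -
  have "T \<subseteq> {x. a \<bullet> x = 1}" using assms by auto
  then have "affine hull T \<subseteq> {x. a \<bullet> x = 1}" by (rule hull_minimal) (rule affine_hyperplane)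
  then have "0 \<notin> affine hull T" by auto
  then have "aff_dim T + 1 = aff_dim (insert 0 T)" by (simp add: aff_dim_insert)
  also have "\<dots> = int (dim (insert 0 T))" by (intro aff_dim_zero hull_inc) auto
  also have "\<dots> = int (dim T)" by (simp add: dim_insert span_zero)
  finally show ?thesis .
qed

lemma span_Int_hyperplane_subset_affine_hull:
  fixes T :: "'a::euclidean_space set"
  assumes "\<And>x. x \<in> T \<Longrightarrow> a \<bullet> x = 1" "x \<in> span T" "a \<bullet> x = 1"
  shows "x \<in> affine hull T"
proof (rule ccontr)
  assume "x \<notin> affine hull T"
  then have "aff_dim (insert x T) = aff_dim T + 1" by (simp add: aff_dim_insert)
  moreover have "aff_dim (insert x T) + 1 = int (dim (insert x T))"
    using assms by (intro aff_dim_eq_dim_hyperplane[of _ a]) auto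
  moreover have "dim (insert x T) = dim T" using assms by (simp add: dim_insert)
  ultimately show False using aff_dim_eq_dim_hyperplane[of T a] assms by simp
qed

lemma span_nonzero_multiples:
  fixes f :: "'i \<Rightarrow> 'a::real_vector"
  assumes "\<And>i. i \<in> I \<Longrightarrow> c i \<noteq> 0"
  shows "span ((\<lambda>i. c i *\<^sub>R f i) ` I) = span (f ` I)"
proof (subst span_eq, intro conjI)
  show "(\<lambda>i. c i *\<^sub>R f i) ` I \<subseteq> span (f ` I)" by (auto intro: span_base span_scale)
  show "f ` I \<subseteq> span ((\<lambda>i. c i *\<^sub>R f i) ` I)"
  proof safe
    fix i assume "i \<in> I"
    then have "inverse (c i) *\<^sub>R (c i *\<^sub>R f i) \<in> span ((\<lambda>i. c i *\<^sub>R f i) ` I)"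
      by (intro span_scale span_base) auto
    then show "f i \<in> span ((\<lambda>i. c i *\<^sub>R f i) ` I)" using assms[OF \<open>i \<in> I\<close>] by simp
  qed
qed

text \<open>Of three distinct collinear points one lies strictly between the other two; the position
  of \<open>v\<close> relative to 0 and 1 decides which.\<close>

lemma extreme_points_not_collinear:
  fixes x y z :: "'a::euclidean_space"
  assumes "x extreme_point_of P" "y extreme_point_of P" "z extreme_point_of P" "convex P"
    and "x \<noteq> y" "x \<noteq> z" "y \<noteq> z"
  shows "x \<notin> affine hull {y, z}"
proof
  assume "x \<in> affine hull {y, z}"
  then obtain u v where uv: "u + v = 1" "x = u *\<^sub>R y + v *\<^sub>R z" by (auto simp: affine_hull_2)
  then have u: "u = 1 - v" by simp
  have x: "x = y + v *\<^sub>R (z - y)" using uv u by (simp add: algebra_simps)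
  have mem: "x \<in> P" "y \<in> P" "z \<in> P" using assms by (auto simp: extreme_point_of_def)
  consider "v = 0" | "v = 1" | "0 < v" "v < 1" | "v < 0" | "v > 1" by linarith
  then show False
  proof cases
    case 3
    then have "x \<in> open_segment y z" using x assms by (auto simp: in_segment algebra_simps intro!: exI[of _ v])
    then show False using assms mem by (auto simp: extreme_point_of_def)
  next
    case 4
    let ?t = "- v / (1 - v)"
    have "(1 - ?t) *\<^sub>R x + ?t *\<^sub>R z = y + (v - ?t * v + ?t) *\<^sub>R (z - y)" by (simp add: x algebra_simps)
    also have "v - ?t * v + ?t = 0" using 4 by (simp add: field_simps)
    finally have "y = (1 - ?t) *\<^sub>R x + ?t *\<^sub>R z" by simp
    moreover have "0 < ?t" "?t < 1" using 4 by (auto simp: field_simps)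
    ultimately have "y \<in> open_segment x z" using assms unfolding in_segment by blast
    then show False using assms mem by (auto simp: extreme_point_of_def)
  next
    case 5
    let ?t = "1 / v"
    have "(1 - ?t) *\<^sub>R y + ?t *\<^sub>R x = y + (?t * v) *\<^sub>R (z - y)" by (simp add: x algebra_simps)
    also have "?t * v = 1" using 5 by simp
    finally have "z = (1 - ?t) *\<^sub>R y + ?t *\<^sub>R x" by simp
    moreover have "0 < ?t" "?t < 1" using 5 by (auto simp: field_simps)
    ultimately have "z \<in> open_segment y x" using assms unfolding in_segment by blast
    then show False using assms mem by (auto simp: extreme_point_of_def)
  qed (use x assms in auto)
qed

text \<open>This turns the combinatorics of a realization into linear algebra. Central projection
  gives a Euclidean polytope \<open>P'\<close> with the face lattice of \<open>P\<close>; its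
  vertices are positive multiples of the \<open>V v\<close>, so spans agree.\<close>

lemma realization_space_span:
  fixes P :: "'a::euclidean_space set"
  assumes P: "polytope P" and V: "V \<in> realization_space P"
  shows "F face_of P \<Longrightarrow> int (dim (V ` (vertices P \<inter> F))) = aff_dim F + 1"
    and "F face_of P \<Longrightarrow> v \<in> vertices P \<Longrightarrow> V v \<in> span (V ` (vertices P \<inter> F)) \<longleftrightarrow> v \<in> F"
    and "{u, v, w} \<subseteq> vertices P \<Longrightarrow> u \<noteq> v \<Longrightarrow> u \<noteq> w \<Longrightarrow> v \<noteq> w \<Longrightarrow> V u \<notin> span {V v, V w}"
proof -
  let ?W = "vertices P"
  have finW: "finite ?W"
    using finite_polyhedron_extreme_points[OF polytope_imp_polyhedron[OF P]]
    by (simp add: vertices_def)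
  obtain \<phi> where \<phi>: "lattice_iso \<phi> (faces P) (spherical_faces (spherical_hull (V ` ?W)))"
    and \<phi>v: "\<And>v. v \<in> ?W \<Longrightarrow> \<phi> {v} = {V v}"
    using V by (auto simp: realization_space_def)
  have "in_open_hemisphere (V ` ?W)" using V by (simp add: realization_space_def)
  then have sph: "V ` ?W \<subseteq> sphere 0 1" and "\<exists>a. \<forall>x\<in>V ` ?W. a \<bullet> x > 0"
    by (simp_all add: in_open_hemisphere_def)
  then obtain a where a: "\<And>x. x \<in> V ` ?W \<Longrightarrow> a \<bullet> x > 0" by blast
  have finS: "finite (V ` ?W)" using finW by simp
  define X where "X v = gnomonic a (V v)" for v
  define P' where "P' = convex hull (X ` ?W)"
  have P'_eq: "P' = convex hull (gnomonic a ` V ` ?W)" by (simp add: P'_def X_def[abs_def] image_image)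
  note ctx = finS sph a
  have P': "polytope P'" using finW by (simp add: P'_def polytope_convex_hull)
  define \<psi> where "\<psi> = inv_into (faces P') (image sgn) \<circ> \<phi>"
  have sgn_iso: "lattice_iso (image sgn) (faces P') (spherical_faces (spherical_hull (V ` ?W)))"
    unfolding P'_eq by (rule lattice_iso_sgn_gnomonic[OF ctx])
  have iso: "lattice_iso \<psi> (faces P) (faces P')" and sgn_\<psi>: "\<And>F. F \<in> faces P \<Longrightarrow> sgn ` \<psi> F = \<phi> F"
    unfolding \<psi>_def using lattice_iso_inv_comp[OF \<phi> sgn_iso] by auto
  note D = lattice_isoD[OF iso, unfolded faces_def mem_Collect_eq]
  have inj: "inj_on sgn P'" unfolding P'_eq by (rule inj_on_sgn_gnomonic_hull[OF ctx])
  have a1: "a \<bullet> x = 1" if "x \<in> P'" for x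
    using that gnomonic_hull_hyperplane[OF ctx] unfolding P'_eq by blast
  have XP: "X v \<in> P'" if "v \<in> ?W" for v using that by (auto simp: P'_def hull_inc)
  have vface: "{v} face_of P" if "v \<in> ?W" for v using that by (simp add: vertices_def face_of_singleton)
  have sgnX: "sgn (X v) = V v" if "v \<in> ?W" for v
  proof -
    have "sgn (X v) = sgn (V v)" using a[of "V v"] that by (simp add: X_def gnomonic_def sgn_scaleR)
    then show ?thesis using sph that by (auto simp: sgn_div_norm)
  qed
  have \<psi>v: "\<psi> {v} = {X v}" if v: "v \<in> ?W" for v
  proof -
    have "sgn ` \<psi> {v} = sgn ` {X v}" using sgn_\<psi> vface[OF v] \<phi>v v sgnX by (simp add: faces_def)
    moreover have "\<psi> {v} \<subseteq> P'" using D(1)[OF vface[OF v]] face_of_imp_subset by blast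
    ultimately show ?thesis using inj_on_image_eq_iff[OF inj, of "\<psi> {v}" "{X v}"] XP[OF v] by blast
  qed
  have mem: "X v \<in> \<psi> F \<longleftrightarrow> v \<in> F" if "v \<in> ?W" "F face_of P" for v F
    using D(2)[OF vface[OF that(1)] that(2)] \<psi>v that by simp
  \<comment> \<open>The isomorphism respects labels, so the vertices of \<open>\<psi> F\<close> come
    from the vertices of \<open>F\<close>.\<close>
  have hull: "\<psi> F = convex hull (X ` (?W \<inter> F))" if F: "F face_of P" for F
  proof
    have "\<psi> F face_of convex hull (X ` ?W)" using D(1)[OF F] by (simp add: P'_def)
    then obtain T where T: "T \<subseteq> X ` ?W" "\<psi> F = convex hull T"
      by (rule face_of_convex_hull_subset[OF finite_imp_compact[OF finite_imageI[OF finW]]])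
    have "T \<subseteq> X ` (?W \<inter> F)"
    proof
      fix t assume t: "t \<in> T"
      then obtain v where "v \<in> ?W" "t = X v" using T by auto
      moreover have "t \<in> \<psi> F" using t T by (simp add: hull_inc)
      ultimately show "t \<in> X ` (?W \<inter> F)" using mem F by auto
    qed
    then show "\<psi> F \<subseteq> convex hull (X ` (?W \<inter> F))" unfolding T(2) by (rule hull_mono)
    show "convex hull (X ` (?W \<inter> F)) \<subseteq> \<psi> F"
      using mem F D(1)[OF F] face_of_imp_convex by (intro hull_minimal) auto
  qed
  have Vmul: "X ` U = (\<lambda>v. inverse (a \<bullet> V v) *\<^sub>R V v) ` U" for U
    by (auto simp: X_def gnomonic_def)
  have spanX: "span (X ` U) = span (V ` U)" if "U \<subseteq> ?W" for U
    unfolding Vmul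
  proof (rule span_nonzero_multiples)
    fix v assume "v \<in> U"
    then have "a \<bullet> V v > 0" using a that by blast
    then show "inverse (a \<bullet> V v) \<noteq> 0" by simp
  qed
  have span\<psi>: "span (\<psi> F) = span (V ` (?W \<inter> F))" if "F face_of P" for F
    using hull[OF that] spanX[of "?W \<inter> F"] convex_hull_subset_span[of "X ` (?W \<inter> F)"]
      span_mono[OF hull_subset[of "X ` (?W \<inter> F)" convex]] span_mono[of "\<psi> F" "span (X ` (?W \<inter> F))"]
    by (simp add: span_span)
  have \<psi>a1: "a \<bullet> x = 1" if "x \<in> \<psi> F" "F face_of P" for x F
    using that D(1) face_of_imp_subset a1 by blast
  show "int (dim (V ` (?W \<inter> F))) = aff_dim F + 1" if F: "F face_of P"
  proof -
    have "int (dim (V ` (?W \<inter> F))) = int (dim (\<psi> F))" using span\<psi>[OF F] by (metis dim_span)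
    also have "\<dots> = aff_dim (\<psi> F) + 1" using aff_dim_eq_dim_hyperplane[of "\<psi> F" a] \<psi>a1 F by simp
    finally show ?thesis using lattice_iso_aff_dim[OF P P' iso F] by simp
  qed
  have Xspan: "X v \<in> span A \<longleftrightarrow> V v \<in> span A" if "v \<in> ?W" for v A
  proof -
    have "a \<bullet> V v > 0" using a that by auto
    then have "V v = (a \<bullet> V v) *\<^sub>R X v" "X v = inverse (a \<bullet> V v) *\<^sub>R V v"
      by (simp_all add: X_def gnomonic_def)
    then show ?thesis by (metis span_scale)
  qed
  show "V v \<in> span (V ` (?W \<inter> F)) \<longleftrightarrow> v \<in> F" if F: "F face_of P" and v: "v \<in> ?W"
  proof
    assume "V v \<in> span (V ` (?W \<inter> F))"
    then have "X v \<in> span (\<psi> F)" using Xspan v span\<psi>[OF F] by simp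
    then have "X v \<in> affine hull (\<psi> F)"
      using span_Int_hyperplane_subset_affine_hull[of "\<psi> F" a] \<psi>a1 F a1 XP v by blast
    \<comment> \<open>A face is the part of the polytope inside its own affine hull.\<close>
    moreover have "\<psi> F = affine hull (\<psi> F) \<inter> P'"
      using face_of_imp_eq_affine_Int[OF polytope_imp_convex[OF P'] D(1)[OF F]] by simp
    ultimately have "X v \<in> \<psi> F" using XP v by blast
    then show "v \<in> F" using mem v F by simp
  next
    assume "v \<in> F" then show "V v \<in> span (V ` (?W \<inter> F))" using v by (intro span_base) auto
  qed
  show "V u \<notin> span {V v, V w}" if W: "{u, v, w} \<subseteq> ?W" and ne: "u \<noteq> v" "u \<noteq> w" "v \<noteq> w"
  proof
    assume "V u \<in> span {V v, V w}"
    then have "X u \<in> span {X v, X w}" using spanX[of "{v, w}"] Xspan W by simp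
    then have "X u \<in> affine hull {X v, X w}"
      using span_Int_hyperplane_subset_affine_hull[of "{X v, X w}" a] a1 XP W by blast
    moreover have "X t extreme_point_of P'" if "t \<in> ?W" for t
      using D(1)[OF vface[OF that]] \<psi>v[OF that] by (simp add: face_of_singleton)
    moreover have "X s \<noteq> X t" if "s \<in> ?W" "t \<in> ?W" "s \<noteq> t" for s t
      using that \<psi>v D(2)[OF vface vface, of s t] by auto
    ultimately show False
      using extreme_points_not_collinear[of "X u" P' "X v" "X w"] W ne polytope_imp_convex[OF P'] by auto
  qed
qed

section \<open>Corners of cubes in realizations\<close>

text \<open>Three distinct vertices are linearly independent, and a face of dimension at most 2
  spans at most three linear dimensions.\<close>

lemma realization_square_span:
  fixes P :: "'a::euclidean_space set"
  assumes P: "polytope P" and V: "V \<in> realization_space P"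
    and F: "F face_of P" "vertices P \<inter> F = {w, x, y, z}" "aff_dim F \<le> 2"
    and "x \<noteq> y" "x \<noteq> z" "y \<noteq> z"
  shows "V w \<in> span {V x, V y, V z}"
proof -
  note span = realization_space_span[OF P V]
  have vert: "{w, x, y, z} \<subseteq> vertices P" using F by auto
  have x: "V x \<notin> span {V y, V z}" and y: "V y \<notin> span {V z, V x}" and z: "V z \<notin> span {V x, V y}"
    using assms vert by (intro span(3); auto)+
  have "V y \<notin> span {V z}" using y span_mono[of "{V z}" "{V z, V x}"] by auto
  moreover have "V z \<noteq> 0" using z span_zero by metis
  ultimately have ind: "independent {V x, V y, V z}"
    using x by (auto simp: independent_insert span_base)
  have "V x \<noteq> V y" "V x \<noteq> V z" "V y \<noteq> V z" using x y by (auto intro: span_base)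
  then have "card {V x, V y, V z} = 3" by simp
  moreover have "dim (V ` {w, x, y, z}) \<le> 3" using span(1)[OF F(1)] F(2,3) by simp
  ultimately have "V ` {w, x, y, z} \<subseteq> span {V x, V y, V z}"
    using ind by (intro card_ge_dim_independent) auto
  then show ?thesis by simp
qed

text \<open>The planes of three faces meeting pairwise in the edges from \<open>w\<close> to \<open>u1\<close>, \<open>u2\<close>, \<open>u3\<close> intersect
  only in \<open>w\<close>, and each of them is spanned by its three other vertices.\<close>

lemma realization_corner_determined:
  fixes P :: "'a::euclidean_space set"
  assumes P: "polytope P" and V: "V \<in> realization_space P" and V': "V' \<in> realization_space P"
    and F12: "F12 face_of P" "vertices P \<inter> F12 = {w, u1, u2, z12}" "aff_dim F12 \<le> 2"
    and F13: "F13 face_of P" "vertices P \<inter> F13 = {w, u1, u3, z13}" "aff_dim F13 \<le> 2"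
    and F23: "F23 face_of P" "vertices P \<inter> F23 = {w, u2, u3, z23}" "aff_dim F23 \<le> 2"
    and dist: "distinct [w, u1, u2, u3, z12, z13, z23]"
    and agree: "\<And>v. v \<in> {u1, u2, u3, z12, z13, z23} \<Longrightarrow> V' v = V v"
  shows "V' w \<in> span {V w}"
proof -
  let ?y = "V' w"
  have in_span: "?y \<in> span {V w, V x, V y}"
    if F: "F face_of P" "vertices P \<inter> F = {w, x, y, z}" "aff_dim F \<le> 2"
      and ne: "w \<noteq> x" "w \<noteq> y" "x \<noteq> y" "x \<noteq> z" "y \<noteq> z" and eq: "V' x = V x" "V' y = V y" "V' z = V z" for F x y z
  proof -
    \<comment> \<open>\<open>V'\<close> is controlled on \<open>x\<close>, \<open>y\<close>,
      \<open>z\<close> only; exchanging \<open>z\<close> for \<open>w\<close> places their span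
      inside one through \<open>V w\<close>, the vector common to all three faces.\<close>
    have "V z \<in> span {V w, V x, V y}"
      using F ne by (intro realization_square_span[OF P V, of F]) auto
    then have "span {V x, V y, V z} \<subseteq> span {V w, V x, V y}"
      by (intro span_minimal) (auto intro: span_base)
    moreover have "?y \<in> span {V' x, V' y, V' z}"
      using F ne by (intro realization_square_span[OF P V', of F]) auto
    ultimately show ?thesis using eq by auto
  qed
  have y12: "?y \<in> span {V w, V u1, V u2}" using in_span[OF F12] dist agree by auto
  have y13: "?y \<in> span {V w, V u1, V u3}" using in_span[OF F13] dist agree by auto
  have y23: "?y \<in> span {V w, V u2, V u3}" using in_span[OF F23] dist agree by auto
  have vert: "u1 \<in> vertices P" "u3 \<in> vertices P" using F12 F13 by auto
  have "u3 \<notin> F12" using F12(2) vert dist by auto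
  then have "V u3 \<notin> span (V ` (vertices P \<inter> F12))" using realization_space_span(2)[OF P V F12(1)] vert by simp
  then have u3: "V u3 \<notin> span {V w, V u1, V u2}"
    unfolding F12(2) using span_mono[of "{V w, V u1, V u2}" "V ` {w, u1, u2, z12}"] by auto
  have "u1 \<notin> F23" using F23(2) vert dist by auto
  then have "V u1 \<notin> span (V ` (vertices P \<inter> F23))" using realization_space_span(2)[OF P V F23(1)] vert by simp
  then have u1: "V u1 \<notin> span {V w, V u2, V u3}"
    unfolding F23(2) using span_mono[of "{V w, V u2, V u3}" "V ` {w, u2, u3, z23}"] by auto
  \<comment> \<open>Exchange argument: otherwise \<open>a\<close> would lie in the span of
    \<open>y\<close> and \<open>A\<close>, hence in that of \<open>B\<close>. Applied twice, it cuts
    the three spans down to that of \<open>V w\<close> and \<open>V u1\<close> and then to the line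
    of \<open>V w\<close>.\<close>
  have drop: "y \<in> span A" if "y \<in> span (insert a A)" "y \<in> span B" "A \<subseteq> B" "a \<notin> span B" for y a :: "'a \<times> real" and A B
  proof (rule ccontr)
    assume "y \<notin> span A"
    then have "a \<in> span (insert y A)" using that(1) by (rule in_span_insert[rotated])
    moreover have "span (insert y A) \<subseteq> span B"
      using that(2,3) by (intro span_minimal) (auto intro: span_base)
    ultimately show False using that(4) by auto
  qed
  have "{V w, V u1, V u3} = insert (V u3) {V w, V u1}" by auto
  then have "?y \<in> span {V w, V u1}" using drop[of ?y "V u3" "{V w, V u1}" "{V w, V u1, V u2}"] y13 y12 u3 by auto
  moreover have "{V w, V u1} = insert (V u1) {V w}" by auto
  ultimately show ?thesis using drop[of ?y "V u1" "{V w}" "{V w, V u2, V u3}"] y23 u1 by auto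
qed

section \<open>Dimension bounds from local charts\<close>

text \<open>If \<open>D < k\<close>, the image is open in the space of the first \<open>k\<close>
  coordinates by invariance of domain, so coordinate \<open>D\<close> could be varied inside it,
  although it vanishes on the whole image.\<close>

lemma no_injection_into_lower_Euclidean_space:
  assumes U: "openin (Euclidean_space k) U" "U \<noteq> {}"
    and f: "continuous_on U f" "inj_on f U" "\<And>x i. x \<in> U \<Longrightarrow> i \<ge> D \<Longrightarrow> f x i = (0::real)"
  shows "k \<le> D"
proof (rule ccontr)
  assume "\<not> k \<le> D"
  then have "D < k" by simp
  have U0: "U \<subseteq> {x. \<forall>i\<ge>k. x i = 0}" using openin_subset[OF U(1)] by (simp add: topspace_Euclidean_space)
  have "continuous_map (subtopology (Euclidean_space k) U) (Euclidean_space k) f"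
    unfolding Euclidean_space_def euclidean_product_topology continuous_map_in_subtopology subtopology_subtopology
    using f(1,3) \<open>D < k\<close> U0 by (auto simp: continuous_map_iff_continuous intro: continuous_on_subset)
  then have "openin (Euclidean_space k) (f ` U)"
    by (rule invariance_of_domain_Euclidean_space[OF U(1) _ f(2)])
  then obtain W where W: "open W" "f ` U = W \<inter> {x. \<forall>i\<ge>k. x i = 0}"
    by (auto simp: Euclidean_space_def euclidean_product_topology openin_subtopology)
  obtain x where x: "x \<in> U" using U by auto
  define \<gamma> where "\<gamma> t = (f x)(D := t)" for t :: real
  have "continuous_on UNIV \<gamma>"
    unfolding \<gamma>_def fun_upd_def
  proof (intro continuous_on_coordinatewise_then_product)
    show "continuous_on UNIV (\<lambda>t. if i = D then t else f x i)" for i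
      by (cases "i = D") (auto intro: continuous_intros)
  qed
  then have "open (\<gamma> -` W)" using W(1) by (simp add: continuous_on_open_vimage)
  moreover have "\<gamma> 0 = f x" using f(3)[OF x, of D] by (auto simp: \<gamma>_def)
  then have "0 \<in> \<gamma> -` W" using W(2) x by auto
  ultimately obtain e where e: "e > 0" "ball 0 e \<subseteq> \<gamma> -` W" by (meson open_contains_ball)
  have "e / 2 \<in> ball 0 e" using e by simp
  then have "\<gamma> (e / 2) \<in> W" using e(2) by (meson subsetD vimageD)
  moreover have "\<gamma> (e / 2) i = 0" if "i \<ge> k" for i using that \<open>D < k\<close> f(3)[OF x, of i] by (simp add: \<gamma>_def)
  ultimately have "\<gamma> (e / 2) \<in> f ` U" using W(2) by simp
  then have "\<gamma> (e / 2) D = 0" using f(3) by auto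
  then show False using e by (simp add: \<gamma>_def)
qed

text \<open>Only the continuity and injectivity of a cell's parametrization matter for the upper bound;
  by invariance of domain, local continuous injections into $\mathbb{R}^D$ suffice.\<close>

lemma semialgebraic_dim_le:
  fixes A :: "('j \<Rightarrow> real) set"
  assumes chart: "\<And>x. x \<in> A \<Longrightarrow> \<exists>U \<Phi>. open U \<and> x \<in> U \<and> continuous_on (A \<inter> U) \<Phi> \<and> inj_on \<Phi> (A \<inter> U) \<and>
      (\<forall>y\<in>A \<inter> U. \<forall>i\<ge>D. \<Phi> y i = (0::real))"
  shows "semialgebraic_dim J A \<le> ereal (real D)"
  unfolding semialgebraic_dim_def
proof (rule SUP_least, safe)
  fix k assume "contains_open_cell J A k"
  then obtain f g where fA: "f ` open_cube k \<subseteq> A" and hom: "homeomorphism (open_cube k) (f ` open_cube k) f g"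
    by (auto simp: contains_open_cell_def)
  have contf: "continuous_on (open_cube k) f" and injf: "inj_on f (open_cube k)"
    using hom by (auto simp: homeomorphism_def inj_on_def) metis
  define c where "c = (\<lambda>i\<in>{..<k}. 1/2 :: real)"
  have c: "c \<in> open_cube k" by (auto simp: c_def open_cube_def)
  obtain U \<Phi> where U: "open U" "f c \<in> U" "continuous_on (A \<inter> U) \<Phi>" "inj_on \<Phi> (A \<inter> U)"
    and \<Phi>0: "\<forall>y\<in>A \<inter> U. \<forall>i\<ge>D. \<Phi> y i = (0::real)"
    using chart[OF subsetD[OF fA imageI[OF c]]] by (elim exE conjE)
  \<comment> \<open>Cells are parametrized by extensional functions on \<open>{..<k}\<close>,
    whereas invariance of domain concerns sequences that vanish from \<open>k\<close> on;
    \<open>r\<close> passes from the latter to the former.\<close>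
  define r where "r y = restrict y {..<k}" for y :: "nat \<Rightarrow> real"
  define E where "E = {y :: nat \<Rightarrow> real. \<forall>i\<ge>k. y i = 0}"
  define B :: "(nat \<Rightarrow> real) set" where "B = (\<Inter>i\<in>{..<k}. (\<lambda>y. y i) -` {0<..<1})"
  have "open B" unfolding B_def
    by (intro open_INT ballI open_vimage) auto
  have contr: "continuous_on UNIV r" unfolding r_def
  proof (intro continuous_on_coordinatewise_then_product)
    show "continuous_on UNIV (\<lambda>y. restrict y {..<k} i)" for i
      by (cases "i < k") auto
  qed
  have rB: "r y \<in> open_cube k" if "y \<in> B" for y using that by (auto simp: r_def B_def open_cube_def)
  have "continuous_on B (f \<circ> r)"
    by (rule continuous_on_compose) (use contr contf rB in \<open>auto intro: continuous_on_subset\<close>)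
  then have "open (B \<inter> (f \<circ> r) -` U)"
    using \<open>open B\<close> U(1) by (metis continuous_on_open_vimage Int_commute)
  define W where "W = B \<inter> (f \<circ> r) -` U \<inter> E"
  have "openin (Euclidean_space k) W"
    using \<open>open (B \<inter> (f \<circ> r) -` U)\<close>
    by (auto simp: Euclidean_space_def euclidean_product_topology openin_subtopology W_def E_def)
  moreover have "(\<lambda>i. if i < k then 1/2 else 0) \<in> W"
  proof -
    have "r (\<lambda>i. if i < k then 1/2 else 0) = c" by (auto simp: r_def c_def)
    then show ?thesis using U(2) by (auto simp: W_def B_def E_def)
  qed
  moreover have im: "(f \<circ> r) ` W \<subseteq> A \<inter> U" using rB fA by (auto simp: W_def)
  moreover have "continuous_on W (\<Phi> \<circ> (f \<circ> r))"
  proof (rule continuous_on_compose)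
    show "continuous_on W (f \<circ> r)"
      using \<open>continuous_on B (f \<circ> r)\<close> by (rule continuous_on_subset) (auto simp: W_def)
    show "continuous_on ((f \<circ> r) ` W) \<Phi>" using U(3) im by (rule continuous_on_subset)
  qed
  moreover have "inj_on (\<Phi> \<circ> (f \<circ> r)) W"
  proof -
    have "inj_on r W"
    proof
      fix x y assume xy: "x \<in> W" "y \<in> W" "r x = r y"
      show "x = y"
      proof
        show "x i = y i" for i
        proof (cases "i < k")
          case True
          have "r x i = r y i" using xy(3) by simp
          then show ?thesis using True by (simp add: r_def)
        next
          case False
          then show ?thesis using xy(1,2) by (simp add: W_def E_def)
        qed
      qed
    qed
    moreover have "inj_on f (r ` W)" using injf rB by (auto simp: W_def intro: inj_on_subset)
    ultimately have "inj_on (f \<circ> r) W" by (rule comp_inj_on)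
    then show ?thesis using inj_on_subset[OF U(4) im] by (rule comp_inj_on)
  qed
  ultimately have "k \<le> D"
    by (intro no_injection_into_lower_Euclidean_space[of k W "\<Phi> \<circ> (f \<circ> r)" D]) (use im \<Phi>0 in auto)
  then show "ereal (real k) \<le> ereal (real D)" by simp
qed

section \<open>Linear independence under small perturbations\<close>

lemma span_image_sum:
  assumes "finite I" "x \<in> span (f ` I)"
  obtains c where "x = (\<Sum>i\<in>I. c i *\<^sub>R f i)"
proof -
  let ?S = "range (\<lambda>c. \<Sum>i\<in>I. c i *\<^sub>R f i)"
  have "subspace ?S"
  proof (rule subspaceI)
    show "0 \<in> ?S" by (rule range_eqI[of _ _ "\<lambda>_. 0"]) simp
    show "x + y \<in> ?S" if "x \<in> ?S" "y \<in> ?S" for x y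
    proof -
      from that obtain a b where "x = (\<Sum>i\<in>I. a i *\<^sub>R f i)" "y = (\<Sum>i\<in>I. b i *\<^sub>R f i)" by blast
      then show ?thesis
        by (intro range_eqI[of _ _ "\<lambda>i. a i + b i"]) (simp add: scaleR_add_left sum.distrib)
    qed
    show "u *\<^sub>R x \<in> ?S" if "x \<in> ?S" for u x
    proof -
      from that obtain a where "x = (\<Sum>i\<in>I. a i *\<^sub>R f i)" by blast
      then show ?thesis
        by (intro range_eqI[of _ _ "\<lambda>i. u * a i"]) (simp add: scaleR_sum_right)
    qed
  qed
  moreover have "f ` I \<subseteq> ?S"
  proof safe
    fix i assume "i \<in> I"
    then show "f i \<in> ?S" using \<open>finite I\<close>
      by (intro range_eqI[of _ _ "\<lambda>j. if j = i then 1 else 0"])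
        (simp add: if_distrib[of "\<lambda>c. c *\<^sub>R _"] cong: if_cong)
  qed
  ultimately have "span (f ` I) \<subseteq> ?S" by (rule span_minimal[rotated])
  then show thesis using assms(2) that by blast
qed

text \<open>The vector for \<open>j\<close> is the component of \<open>f j\<close> orthogonal to all
  other vectors of the family, rescaled.\<close>

lemma dual_family_exists:
  fixes f :: "'i \<Rightarrow> 'a::euclidean_space"
  assumes inj: "inj_on f I" and ind: "independent (f ` I)"
  obtains w where "\<And>i j. i \<in> I \<Longrightarrow> j \<in> I \<Longrightarrow> w j \<bullet> f i = (if i = j then 1 else 0)"
proof -
  have "\<exists>w. \<forall>i\<in>I. w \<bullet> f i = (if i = j then 1 else 0)" if j: "j \<in> I" for j
  proof -
    let ?S = "f ` (I - {j})"
    obtain y z where yz: "y \<in> span ?S" "\<And>u. u \<in> span ?S \<Longrightarrow> orthogonal z u" "f j = y + z"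
      using orthogonal_subspace_decomp_exists[of ?S "f j"] by metis
    have "f ` I - {f j} = ?S" using inj j by (auto simp: inj_on_def)
    then have "f j \<notin> span ?S" using ind j by (metis dependent_def imageI)
    then have "z \<noteq> 0" using yz by auto
    have zf: "z \<bullet> f i = 0" if "i \<in> I" "i \<noteq> j" for i
      using yz(2)[of "f i"] that by (auto simp: orthogonal_def intro: span_base)
    have zj: "z \<bullet> f j = z \<bullet> z" using yz by (simp add: inner_add_right orthogonal_def)
    show ?thesis
      using zf zj \<open>z \<noteq> 0\<close> by (intro exI[of _ "z /\<^sub>R (z \<bullet> z)"]) auto
  qed
  then obtain w where "\<forall>j\<in>I. \<forall>i\<in>I. w j \<bullet> f i = (if i = j then 1 else 0)" by metis
  then show thesis using that by blast
qed

text \<open>A strictly diagonally dominant matrix is regular.\<close>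

lemma near_dual_family_coeffs_zero:
  fixes f w :: "'i \<Rightarrow> 'a::euclidean_space"
  assumes fin: "finite I"
    and near: "\<And>i j. i \<in> I \<Longrightarrow> j \<in> I \<Longrightarrow> \<bar>w j \<bullet> f i - (if i = j then 1 else 0)\<bar> < 1 / real (card I)"
    and zero: "\<And>j. j \<in> I \<Longrightarrow> w j \<bullet> (\<Sum>i\<in>I. c i *\<^sub>R f i) = 0" and "i \<in> I"
  shows "c i = 0"
proof (rule ccontr)
  assume ci: "c i \<noteq> 0"
  define m where "m = Max ((\<lambda>i. \<bar>c i\<bar>) ` I)"
  have "I \<noteq> {}" using \<open>i \<in> I\<close> by auto
  then have "m \<in> (\<lambda>i. \<bar>c i\<bar>) ` I" unfolding m_def using fin by (intro Max_in) auto
  then obtain j where j: "j \<in> I" "m = \<bar>c j\<bar>" by auto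
  have le: "\<bar>c k\<bar> \<le> m" if "k \<in> I" for k unfolding m_def using fin that by (intro Max_ge) auto
  then have m: "m > 0" using ci \<open>i \<in> I\<close> by force
  \<comment> \<open>This is the equation at an index of maximal coefficient: each deviation is below
    \<open>1 / card I\<close>, so together they cannot account for \<open>m\<close>.\<close>
  have "c j = (\<Sum>k\<in>I. c k * (if k = j then 1 else 0))" using j fin by (simp add: if_distrib cong: if_cong)
  also have "\<dots> = (\<Sum>k\<in>I. c k * (if k = j then 1 else 0)) - w j \<bullet> (\<Sum>i\<in>I. c i *\<^sub>R f i)"
    using zero j by simp
  also have "\<dots> = (\<Sum>k\<in>I. - c k * (w j \<bullet> f k - (if k = j then 1 else 0)))"
    by (simp add: inner_sum_right sum_subtractf[symmetric] algebra_simps cong: sum.cong)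
  finally have "\<bar>c j\<bar> \<le> (\<Sum>k\<in>I. \<bar>- c k * (w j \<bullet> f k - (if k = j then 1 else 0))\<bar>)"
    by (metis sum_abs)
  also have "\<dots> \<le> (\<Sum>k\<in>I. m * \<bar>w j \<bullet> f k - (if k = j then 1 else 0)\<bar>)"
    using le by (intro sum_mono) (auto simp: abs_mult intro!: mult_right_mono)
  also have "\<dots> < (\<Sum>k\<in>I. m * (1 / real (card I)))"
    using fin \<open>I \<noteq> {}\<close> m near[OF _ j(1)] by (intro sum_strict_mono mult_strict_left_mono) auto
  also have "\<dots> = m" using fin \<open>I \<noteq> {}\<close> by simp
  finally show False using j by simp
qed

text \<open>Independence persists on an explicit neighbourhood, which becomes part of the domain of
  a chart.\<close>

lemma near_dual_family_independent:
  fixes f w :: "'i \<Rightarrow> 'a::euclidean_space"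
  assumes fin: "finite I"
    and near: "\<And>i j. i \<in> I \<Longrightarrow> j \<in> I \<Longrightarrow> \<bar>w j \<bullet> f i - (if i = j then 1 else 0)\<bar> < 1 / real (card I)"
  shows "inj_on f I" "independent (f ` I)"
proof -
  have coeffs: "c i = 0" if "(\<Sum>i\<in>I. c i *\<^sub>R f i) = 0" "i \<in> I" for c i
    by (rule near_dual_family_coeffs_zero[OF fin near _ that(2)]) (use that in auto)
  show inj: "inj_on f I"
  proof
    fix i j assume ij: "i \<in> I" "j \<in> I" "f i = f j"
    show "i = j"
    proof (rule ccontr)
      assume "i \<noteq> j"
      let ?c = "\<lambda>k. if k = i then 1 else if k = j then - 1 else (0::real)"
      have "(\<Sum>k\<in>I. ?c k *\<^sub>R f k) = (\<Sum>k\<in>{i, j}. ?c k *\<^sub>R f k)"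
        using fin ij by (intro sum.mono_neutral_right) auto
      also have "\<dots> = 0" using \<open>i \<noteq> j\<close> ij by simp
      finally have "?c i = 0" using coeffs[of ?c i] ij(1) by simp
      then show False by simp
    qed
  qed
  show "independent (f ` I)"
    unfolding independent_explicit
  proof (intro conjI allI impI ballI)
    show "finite (f ` I)" using fin by simp
    fix u x assume u: "(\<Sum>x\<in>f ` I. u x *\<^sub>R x) = 0" and "x \<in> f ` I"
    then obtain i where i: "i \<in> I" "x = f i" by auto
    have "(\<Sum>i\<in>I. u (f i) *\<^sub>R f i) = 0" using u inj by (simp add: sum.reindex)
    then show "u x = 0" unfolding i(2) using coeffs[of "\<lambda>i. u (f i)" i] i(1) by simp
  qed
qed

lemma positive_multiple_unit_eq:
  fixes x y :: "'a::real_normed_vector"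
  assumes "norm x = 1" "norm y = 1" "y = c *\<^sub>R x" "c > 0"
  shows "y = x"
  using assms by simp

section \<open>Local charts on spaces of configurations\<close>

definition tuple_vec :: "('i \<times> 'b \<Rightarrow> real) \<Rightarrow> 'i \<Rightarrow> 'b::euclidean_space" where
  "tuple_vec t i = (\<Sum>b\<in>Basis. t (i, b) *\<^sub>R b)"

lemma tuple_vec_tuple_coords: "i \<in> I \<Longrightarrow> tuple_vec (tuple_coords I V) i = V i"
  by (simp add: tuple_vec_def tuple_coords_def euclidean_representation)

lemma continuous_on_inner_tuple_vec: "continuous_on S (\<lambda>t. c \<bullet> tuple_vec t i)"
proof -
  have "continuous_on UNIV (\<lambda>t. \<Sum>b\<in>Basis. t (i, b) * (c \<bullet> b))"
    by (intro continuous_on_sum continuous_on_mult_right) simp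
  then show ?thesis by (auto simp: tuple_vec_def inner_sum_right intro: continuous_on_subset)
qed

text \<open>Near a given configuration, choose a basis of the span of \<open>T\<close> among its vectors and the dual
  basis. Basis vectors and the vectors in \<open>A\<close> are recorded as points of projective space, and the
  remaining vectors of \<open>T\<close> as points of an \<open>(r - 1)\<close>-dimensional projective space, in coordinates
  given by the dual basis.\<close>

lemma configuration_space_dim_le:
  fixes \<R> :: "('i \<Rightarrow> 'e::euclidean_space) set" and W T A :: "'i set"
  assumes fin: "finite W" and sub: "T \<subseteq> W" "A \<subseteq> W" "T \<inter> A = {}"
    and unit: "\<And>V v. V \<in> \<R> \<Longrightarrow> v \<in> W \<Longrightarrow> norm (V v) = 1"
    and dim: "\<And>V. V \<in> \<R> \<Longrightarrow> dim (V ` T) = r"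
    and determined: "\<And>V V'. V \<in> \<R> \<Longrightarrow> V' \<in> \<R> \<Longrightarrow> \<forall>v\<in>T \<union> A. V v = V' v \<Longrightarrow>
      \<forall>v\<in>W. V' v \<noteq> - V v \<Longrightarrow> V = V'"
  shows "semialgebraic_dim (W \<times> Basis) (tuple_coords W ` \<R>) \<le>
    ereal (real (r * (DIM('e) - 1) + (card T - r) * (r - 1) + card A * (DIM('e) - 1)))"
proof (rule semialgebraic_dim_le)
  fix x assume "x \<in> tuple_coords W ` \<R>"
  then obtain V0 where V0: "V0 \<in> \<R>" "x = tuple_coords W V0" by auto
  note vec = tuple_vec_tuple_coords[of _ W]
  have finT: "finite T" and finA: "finite A" using fin sub by (auto intro: finite_subset)
  obtain B where B: "B \<subseteq> V0 ` T" "independent B" "V0 ` T \<subseteq> span B" "card B = dim (V0 ` T)"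
    by (rule basis_exists)
  then obtain I where I: "I \<subseteq> T" "inj_on V0 I" "B = V0 ` I" by (meson subset_image_inj)
  have finI: "finite I" using I finT by (auto intro: finite_subset)
  have cardI: "card I = r" using I B(4) dim[OF V0(1)] by (simp add: card_image)
  obtain w where w: "\<And>i j. i \<in> I \<Longrightarrow> j \<in> I \<Longrightarrow> w j \<bullet> V0 i = (if i = j then 1 else 0)"
    using dual_family_exists[of V0 I] I B by metis
  have injw: "inj_on w I"
    by (rule inj_onI) (metis w zero_neq_one)
  define Q where "Q v = (if v \<in> T - I then w ` I else Basis)" for v
  have near0: "\<bar>w j \<bullet> V0 i - (if i = j then 1 else 0)\<bar> < 1 / real (card I)" if "i \<in> I" "j \<in> I" for i j
  proof -
    have "card I > 0" using that finI card_gt_0_iff by blast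
    then show ?thesis using w[OF that] by simp
  qed
  have separating: "y = 0"
    if near: "\<And>i j. i \<in> I \<Longrightarrow> j \<in> I \<Longrightarrow> \<bar>w j \<bullet> V i - (if i = j then 1 else 0)\<bar> < 1 / real (card I)"
      and y: "y \<in> span (V ` I)" "\<And>j. j \<in> I \<Longrightarrow> w j \<bullet> y = 0" for V y
  proof -
    obtain c where c: "y = (\<Sum>i\<in>I. c i *\<^sub>R V i)" using span_image_sum[OF finI y(1)] by blast
    have "c i = 0" if "i \<in> I" for i
      using near_dual_family_coeffs_zero[OF finI near _ that] y(2) unfolding c by blast
    then show ?thesis using c by simp
  qed
  have "\<exists>q\<in>Q v. q \<bullet> V0 v \<noteq> 0" if v: "v \<in> T \<union> A" for v
  proof (rule ccontr)
    assume H: "\<not> (\<exists>q\<in>Q v. q \<bullet> V0 v \<noteq> 0)"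
    have "V0 v = 0"
    proof (cases "v \<in> T - I")
      case True
      then have "V0 v \<in> span (V0 ` I)" using B I by auto
      moreover have "w j \<bullet> V0 v = 0" if "j \<in> I" for j using H True that by (simp add: Q_def)
      ultimately show ?thesis using separating[where V = V0, OF near0] by blast
    next
      case False
      then have "Q v = Basis" by (auto simp: Q_def)
      then show ?thesis using H euclidean_all_zero_iff[of "V0 v"] by (metis inner_commute)
    qed
    then show False using unit[OF V0(1), of v] v sub by auto
  qed
  \<comment> \<open>The coordinate \<open>q0 v\<close> is nonzero at \<open>V0\<close> and serves as
    denominator of an affine chart of projective space. Dropping it accounts for each
    \<open>- 1\<close> in the count.\<close>
  then obtain q0 where q0: "\<And>v. v \<in> T \<union> A \<Longrightarrow> q0 v \<in> Q v" "\<And>v. v \<in> T \<union> A \<Longrightarrow> q0 v \<bullet> V0 v \<noteq> 0"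
    by metis
  define K where "K = Sigma (T \<union> A) (\<lambda>v. Q v - {q0 v})"
  have finQ: "finite (Q v)" for v using finI by (auto simp: Q_def)
  have finK: "finite K" using finQ finT finA by (auto simp: K_def)
  let ?D = "r * (DIM('e) - 1) + (card T - r) * (r - 1) + card A * (DIM('e) - 1)"
  have cardK: "card K = ?D"
  proof -
    have "card K = (\<Sum>v\<in>T \<union> A. card (Q v) - 1)"
      unfolding K_def using finQ finT finA q0 by (subst card_SigmaI) (auto simp: card_Diff_singleton)
    also have "T \<union> A = I \<union> (T - I) \<union> A" using I by auto
    also have "(\<Sum>v\<in>I \<union> (T - I) \<union> A. card (Q v) - 1)
        = (\<Sum>v\<in>I. card (Q v) - 1) + (\<Sum>v\<in>T - I. card (Q v) - 1) + (\<Sum>v\<in>A. card (Q v) - 1)"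
      using finI finT finA sub I by (subst sum.union_disjoint; (subst sum.union_disjoint)?; auto)
    also have "(\<Sum>v\<in>I. card (Q v) - 1) = r * (DIM('e) - 1)" using cardI by (simp add: Q_def)
    also have "(\<Sum>v\<in>T - I. card (Q v) - 1) = (card T - r) * (r - 1)"
      using cardI injw finI I by (simp add: Q_def card_image card_Diff_subset)
    also have "(\<Sum>v\<in>A. card (Q v) - 1) = (\<Sum>v\<in>A. DIM('e) - 1)"
      using sub by (intro sum.cong) (auto simp: Q_def)
    finally show ?thesis by simp
  qed
  obtain e where e: "bij_betw e {0..<card K} K" using ex_bij_betw_nat_finite[OF finK] by blast
  define \<rho> where "\<rho> t v q = (q \<bullet> tuple_vec t v) / (q0 v \<bullet> tuple_vec t v)" for t v q
  define \<Phi> where "\<Phi> t n = (if n < card K then \<rho> t (fst (e n)) (snd (e n)) else 0)" for t and n :: nat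
  \<comment> \<open>The three conditions: two configurations in \<open>U\<close> are never antipodal
    at a vertex, the denominators keep their signs, and the vectors indexed by \<open>I\<close>
    remain independent.\<close>
  define U where "U = (\<Inter>v\<in>W. {t. 0 < V0 v \<bullet> tuple_vec t v}) \<inter>
    (\<Inter>v\<in>T \<union> A. {t. 0 < (q0 v \<bullet> tuple_vec t v) * (q0 v \<bullet> V0 v)}) \<inter>
    (\<Inter>i\<in>I. \<Inter>j\<in>I. {t. \<bar>w j \<bullet> tuple_vec t i - (if i = j then 1 else 0)\<bar> < 1 / real (card I)})"
  have "open U"
    unfolding U_def using fin finT finA finI
    by (intro open_Int open_INT ballI open_Collect_less continuous_on_mult_right continuous_intros
        continuous_on_inner_tuple_vec) auto
  have "x \<in> U"
  proof -
    have "V0 v \<bullet> V0 v > 0" if "v \<in> W" for v using unit[OF V0(1) that] by auto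
    moreover have "(q0 v \<bullet> V0 v) * (q0 v \<bullet> V0 v) > 0" if "v \<in> T \<union> A" for v
      using q0(2)[OF that] by (simp add: zero_less_mult_iff) linarith
    ultimately show ?thesis
      using near0 sub I(1) by (auto simp: U_def V0(2) vec subset_iff)
  qed
  have UD: "V0 v \<bullet> V v > 0" "\<And>v. v \<in> T \<union> A \<Longrightarrow> (q0 v \<bullet> V v) * (q0 v \<bullet> V0 v) > 0"
    "\<And>i j. i \<in> I \<Longrightarrow> j \<in> I \<Longrightarrow> \<bar>w j \<bullet> V i - (if i = j then 1 else 0)\<bar> < 1 / real (card I)"
    if "tuple_coords W V \<in> U" "v \<in> W" for V v
  proof -
    show "V0 v \<bullet> V v > 0" using that by (auto simp: U_def vec)
    show "(q0 v \<bullet> V v) * (q0 v \<bullet> V0 v) > 0" if "v \<in> T \<union> A" for v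
    proof -
      have "v \<in> W" using that sub by auto
      moreover have "tuple_coords W V \<in> {t. 0 < (q0 v \<bullet> tuple_vec t v) * (q0 v \<bullet> V0 v)}"
        using \<open>tuple_coords W V \<in> U\<close> that unfolding U_def by blast
      ultimately show ?thesis by (simp add: vec)
    qed
    show "\<bar>w j \<bullet> V i - (if i = j then 1 else 0)\<bar> < 1 / real (card I)" if "i \<in> I" "j \<in> I" for i j
    proof -
      have "i \<in> W" using that sub I by auto
      moreover have "tuple_coords W V \<in> {t. \<bar>w j \<bullet> tuple_vec t i - (if i = j then 1 else 0)\<bar> < 1 / real (card I)}"
        using \<open>tuple_coords W V \<in> U\<close> that unfolding U_def by blast
      ultimately show ?thesis by (simp add: vec)
    qed
  qed
  have "continuous_on U \<Phi>"
  proof (rule continuous_on_coordinatewise_then_product)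
    fix n show "continuous_on U (\<lambda>t. \<Phi> t n)"
    proof (cases "n < card K")
      case True
      then have "e n \<in> K" using e by (auto simp: bij_betw_def)
      then have "fst (e n) \<in> T \<union> A" by (auto simp: K_def)
      then have "U \<subseteq> {t. 0 < (q0 (fst (e n)) \<bullet> tuple_vec t (fst (e n))) * (q0 (fst (e n)) \<bullet> V0 (fst (e n)))}"
        unfolding U_def by blast
      then have "q0 (fst (e n)) \<bullet> tuple_vec t (fst (e n)) \<noteq> 0" if "t \<in> U" for t
        using that by (auto simp: zero_less_mult_iff)
      then show ?thesis using True unfolding \<Phi>_def \<rho>_def
        by (auto intro!: continuous_on_divide continuous_on_inner_tuple_vec)
    qed (simp add: \<Phi>_def)
  qed
  moreover have "inj_on \<Phi> (tuple_coords W ` \<R> \<inter> U)"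
  proof
    fix t t' assume "t \<in> tuple_coords W ` \<R> \<inter> U" "t' \<in> tuple_coords W ` \<R> \<inter> U" and eq: "\<Phi> t = \<Phi> t'"
    then obtain V V' where V: "V \<in> \<R>" "t = tuple_coords W V" "tuple_coords W V \<in> U"
      and V': "V' \<in> \<R>" "t' = tuple_coords W V'" "tuple_coords W V' \<in> U" by auto
    \<comment> \<open>Equal ratios make the values on \<open>Q v\<close> proportional. The factor is
      the quotient of the two denominators, positive because both have the sign taken at
      \<open>V0\<close>.\<close>
    have "\<exists>c>0. \<forall>q\<in>Q v. q \<bullet> V' v = c * (q \<bullet> V v)" if v: "v \<in> T \<union> A" for v
    proof -
      let ?a = "q0 v \<bullet> V v" and ?a' = "q0 v \<bullet> V' v"
      have "v \<in> W" using v sub by auto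
      have a: "?a * (q0 v \<bullet> V0 v) > 0" "?a' * (q0 v \<bullet> V0 v) > 0"
        using UD(2) V(3) V'(3) v \<open>v \<in> W\<close> by blast+
      then have "?a' / ?a > 0" by (auto simp: zero_less_mult_iff zero_less_divide_iff)
      moreover have "q \<bullet> V' v = ?a' / ?a * (q \<bullet> V v)" if q: "q \<in> Q v" for q
      proof (cases "q = q0 v")
        case True then show ?thesis using a by auto
      next
        case False
        then have "(v, q) \<in> e ` {0..<card K}" using q v e by (auto simp: K_def bij_betw_def)
        then obtain n where "n < card K" "e n = (v, q)" by auto
        then have "\<rho> t v q = \<rho> t' v q" using fun_cong[OF eq, of n] by (simp add: \<Phi>_def)
        then have "(q \<bullet> V v) / ?a = (q \<bullet> V' v) / ?a'" using V V' \<open>v \<in> W\<close> by (simp add: \<rho>_def vec)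
        moreover have "?a \<noteq> 0" "?a' \<noteq> 0" using a by auto
        ultimately show ?thesis by (simp add: field_simps)
      qed
      ultimately show ?thesis by blast
    qed
    then obtain c where c: "\<And>v. v \<in> T \<union> A \<Longrightarrow> c v > 0"
      "\<And>v q. v \<in> T \<union> A \<Longrightarrow> q \<in> Q v \<Longrightarrow> q \<bullet> V' v = c v * (q \<bullet> V v)" by metis
    have free: "V' v = V v" if v: "v \<in> T \<union> A" "v \<notin> T - I" for v
    proof -
      have "V' v = c v *\<^sub>R V v"
      proof (rule euclidean_eqI)
        fix b :: 'e assume "b \<in> Basis"
        then have "b \<bullet> V' v = c v * (b \<bullet> V v)" using c(2)[OF v(1), of b] v(2) by (auto simp: Q_def)
        then show "V' v \<bullet> b = (c v *\<^sub>R V v) \<bullet> b" by (simp add: inner_commute)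
      qed
      moreover have "v \<in> W" using v sub by auto
      ultimately show ?thesis
        using positive_multiple_unit_eq[OF unit[OF V(1)] unit[OF V'(1)] _ c(1)[OF v(1)]] by blast
    qed
    have VI: "V' ` I = V ` I" using free I by (intro image_cong) auto
    have span_eq: "V v \<in> span (V ` I)"
      if V: "V \<in> \<R>" "tuple_coords W V \<in> U" and v: "v \<in> T" for V v
    proof -
      have "v \<in> W" using v sub by auto
      note near = UD(3)[OF V(2) \<open>v \<in> W\<close>]
      have "card (V ` I) = r" "independent (V ` I)"
        using near_dual_family_independent[OF finI near] cardI by (auto simp: card_image)
      then have "V ` T \<subseteq> span (V ` I)"
        using dim[OF V(1)] I finT by (intro card_ge_dim_independent) auto
      then show ?thesis using v by auto
    qed
    have "V v = V' v" if v: "v \<in> T \<union> A" for v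
    proof (cases "v \<in> T - I")
      case True
      have "v \<in> W" using v sub by auto
      \<comment> \<open>Both configurations have the same span over \<open>I\<close>, and on it the
        \<open>w j\<close> still separate points.\<close>
      have "V' v - c v *\<^sub>R V v \<in> span (V ` I)"
        using span_eq[OF V(1,3), of v] span_eq[OF V'(1,3), of v] True VI
        by (intro span_diff span_scale) auto
      moreover have "w j \<bullet> (V' v - c v *\<^sub>R V v) = 0" if "j \<in> I" for j
        using c(2)[OF v, of "w j"] True that by (simp add: Q_def inner_diff_right)
      ultimately have "V' v - c v *\<^sub>R V v = 0"
        using separating[of V] UD(3)[OF V(3) \<open>v \<in> W\<close>] by blast
      then have "V' v = c v *\<^sub>R V v" by simp
      then show ?thesis
        using positive_multiple_unit_eq[OF unit[OF V(1)] unit[OF V'(1)] _ c(1)[OF v]] \<open>v \<in> W\<close> by metis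
    qed (use free v in auto)
    moreover have "V' v \<noteq> - V v" if "v \<in> W" for v
      using UD(1)[OF V(3) that] UD(1)[OF V'(3) that] by auto
    ultimately have "V = V'" using determined V(1) V'(1) by blast
    then show "t = t'" using V V' by simp
  qed
  ultimately show "\<exists>U \<Phi>. open U \<and> x \<in> U \<and> continuous_on (tuple_coords W ` \<R> \<inter> U) \<Phi> \<and>
      inj_on \<Phi> (tuple_coords W ` \<R> \<inter> U) \<and>
      (\<forall>y\<in>tuple_coords W ` \<R> \<inter> U. \<forall>i\<ge>?D. \<Phi> y i = (0::real))"
    using \<open>open U\<close> \<open>x \<in> U\<close> cardK
    by (intro exI[of _ U] exI[of _ \<Phi>]) (auto simp: \<Phi>_def intro: continuous_on_subset)
qed

section \<open>The point configuration\<close>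

lemma cos_third_int:
  fixes d :: int
  shows "2 * cos (of_int d * pi / 3) = (if d mod 6 = 0 then 2 else if d mod 6 \<in> {1, 5} then 1
    else if d mod 6 \<in> {2, 4} then - 1 else - 2)"
proof -
  define q r where "q = d div 6" and "r = d mod 6"
  have d: "d = 6 * q + r" by (simp add: q_def r_def)
  have "cos (of_int d * pi / 3) = cos (of_int r * pi / 3 + (2 * pi) * of_int q)"
    by (simp add: d algebra_simps add_divide_distrib)
  also have "\<dots> = cos (of_int r * pi / 3)" by (simp add: cos_add cos_int_2pin sin_int_2pin del: mult.assoc)
  finally have eq: "cos (of_int d * pi / 3) = cos (of_int r * pi / 3)" .
  have "4 * pi / 3 = pi / 3 + pi" "2 * pi / 3 = pi - pi / 3" "5 * pi / 3 = 2 * pi - pi / 3"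
    by simp_all
  then have vals: "cos (4 * pi / 3) = - 1 / 2" "cos (2 * pi / 3) = - 1 / 2" "cos (5 * pi / 3) = 1 / 2"
    by (simp_all only: cos_add cos_diff) (simp_all add: cos_60)
  have "0 \<le> r" "r < 6" by (simp_all add: r_def)
  then have "r \<in> {0, 1, 2, 3, 4, 5}" by auto
  then show ?thesis unfolding eq r_def[symmetric] using vals by (auto simp: cos_60)
qed

lemma cos_sin_quarter_int:
  fixes d :: int
  shows "cos (of_int d * pi / 2) = (if d mod 4 = 0 then 1 else if d mod 4 = 2 then - 1 else 0)"
    and "sin (of_int d * pi / 2) = (if d mod 4 = 1 then 1 else if d mod 4 = 3 then - 1 else 0)"
proof -
  define q r where "q = d div 4" and "r = d mod 4"
  have d: "d = 4 * q + r" by (simp add: q_def r_def)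
  have x: "of_int d * pi / 2 = of_int r * pi / 2 + (2 * pi) * of_int q"
    by (simp add: d algebra_simps add_divide_distrib)
  have c: "cos (of_int d * pi / 2) = cos (of_int r * pi / 2)"
    and s: "sin (of_int d * pi / 2) = sin (of_int r * pi / 2)"
    unfolding x by (simp_all add: cos_add sin_add cos_int_2pin sin_int_2pin del: mult.assoc)
  have "0 \<le> r" "r < 4" by (simp_all add: r_def)
  then have "r \<in> {0, 1, 2, 3}" by auto
  then show "cos (of_int d * pi / 2) = (if d mod 4 = 0 then 1 else if d mod 4 = 2 then - 1 else 0)"
    and "sin (of_int d * pi / 2) = (if d mod 4 = 1 then 1 else if d mod 4 = 3 then - 1 else 0)"
    unfolding c s r_def[symmetric] by (auto simp: cos_3over2_pi[unfolded times_divide_eq_left] sin_3over2_pi[unfolded times_divide_eq_left])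
qed

text \<open>\<open>pc\<close> and \<open>ps\<close> run through the solutions 1, 2, 7, 26, ... and
  0, 1, 4, 15, ... of Pell's equation \<open>x^2 - 3 * y^2 = 1\<close>; the divisor
  \<open>sqrt 3\<close> in \<open>ps\<close> makes the recurrences integral.\<close>

definition pc :: "nat \<Rightarrow> real" where
  "pc i = cosh (real i * arcosh 2)"

definition ps :: "nat \<Rightarrow> real" where
  "ps i = sinh (real i * arcosh 2) / sqrt 3"

lemma sinh_arcosh_2: "sinh (arcosh 2 :: real) = sqrt 3"
proof -
  have "(sinh (arcosh 2 :: real))\<^sup>2 = 3" by (simp add: sinh_square_eq)
  then show ?thesis by (metis arcosh_nonneg_real one_le_numeral real_sqrt_unique sinh_real_nonneg_iff)
qed

lemma pc_0 [simp]: "pc 0 = 1"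
  by (simp add: pc_def)

lemma ps_0 [simp]: "ps 0 = 0"
  by (simp add: ps_def)

lemma pc_Suc: "pc (Suc i) = 2 * pc i + 3 * ps i"
  by (simp add: pc_def ps_def distrib_right cosh_add sinh_arcosh_2 field_simps)

lemma ps_Suc: "ps (Suc i) = pc i + 2 * ps i"
  by (simp add: pc_def ps_def distrib_right sinh_add sinh_arcosh_2 field_simps)

lemma pc_ge_1: "pc i \<ge> 1"
  by (simp add: pc_def cosh_real_ge_1)

lemma ps_ge_0: "ps i \<ge> 0"
  by (simp add: ps_def)

lemma pc_pos [simp]: "pc i > 0"
  using pc_ge_1[of i] by linarith

lemma pc_ne0 [simp]: "pc i \<noteq> 0"
  using pc_pos[of i] by linarith

lemma pell: "(pc i)\<^sup>2 = 1 + 3 * (ps i)\<^sup>2"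
  by (simp add: pc_def ps_def power_divide cosh_square_eq)

lemma pc_inject: "pc i = pc j \<Longrightarrow> i = j"
proof -
  have "pc i < pc j" if "i < j" for i j
  proof -
    have "pc k < pc (Suc k)" for k using pc_ge_1[of k] ps_ge_0[of k] by (simp add: pc_Suc)
    then show ?thesis using that lift_Suc_mono_less[of pc] by blast
  qed
  then show "pc i = pc j \<Longrightarrow> i = j" by (metis linorder_neqE_nat order_less_irrefl)
qed

text \<open>The hyperbolic cosine of the distance between the marked points \<open>i\<close> and
  \<open>j\<close> of one geodesic, expanded by the addition theorem.\<close>

definition gap :: "nat \<Rightarrow> nat \<Rightarrow> real" where "gap i j = pc i * pc j - 3 * ps i * ps j"

lemma gap_eq_cosh: "gap i j = cosh ((real i - real j) * arcosh 2)"
  by (simp add: gap_def pc_def ps_def left_diff_distrib cosh_diff)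

lemma gap_refl [simp]: "gap i i = 1" by (simp add: gap_eq_cosh)

lemma gap_Suc [simp]: "gap i (Suc i) = 2" "gap (Suc i) i = 2" by (simp_all add: gap_eq_cosh)

text \<open>The next value after 1 and 2 is \<open>cosh (2 * arcosh 2) = 7\<close>, out of reach for
  twice a cosine.\<close>

lemma gap_gt_2:
  assumes "i \<noteq> j" "i \<noteq> Suc j" "j \<noteq> Suc i"
  shows "gap i j > 2"
proof -
  have "2 \<le> \<bar>real i - real j\<bar>" using assms by linarith
  then have "2 * arcosh 2 \<le> \<bar>real i - real j\<bar> * arcosh 2" by (intro mult_right_mono) auto
  then have "cosh (2 * arcosh 2) \<le> cosh (\<bar>real i - real j\<bar> * arcosh 2)"
    by (subst cosh_real_nonneg_le_iff) auto
  also have "\<dots> = cosh \<bar>(real i - real j) * arcosh 2\<bar>" by (simp add: abs_mult)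
  also have "\<dots> = gap i j" by (simp add: gap_eq_cosh cosh_real_abs)
  also have "cosh (2 * arcosh 2 :: real) = 7" by (simp add: cosh_double_cosh)
  finally show ?thesis by simp
qed

text \<open>The hyperbolic part of the functional vanishing on a lattice cube, evaluated in layer \<open>i\<close> on the
  geodesic that is \<open>m\<close> quarter turns away from the upper square of the cube. The lower square has
  its two middle vertices in layer \<open>j\<close>.\<close>

definition level_fun :: "nat \<Rightarrow> nat \<Rightarrow> int \<Rightarrow> real" where
  "level_fun j i m =
    ps j * (pc i * cos (of_int m * pi / 2) - 3 * ps i * sin (of_int m * pi / 2)) -
    (pc j + 2 * ps j) * (pc i * sin (of_int m * pi / 2) + 3 * ps i * cos (of_int m * pi / 2)) +
    (pc j + ps j) * (2 * pc i)"

text \<open>On the geodesics of the upper and lower squares, distances are measured from the layer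
  of the square's middle vertices, \<open>Suc j\<close> and \<open>j\<close>. The other two
  geodesics need only lower bounds.\<close>

lemma level_fun_cases:
  "m mod 4 = 0 \<Longrightarrow> level_fun j i m = gap i (Suc j)"
  "m mod 4 = 1 \<Longrightarrow> level_fun j i m = gap i j"
  "m mod 4 = 2 \<Longrightarrow> level_fun j i m = pc i * (2 * pc j + ps j) + 3 * ps i * (pc j + 2 * ps j)"
  "m mod 4 = 3 \<Longrightarrow> level_fun j i m = pc i * (3 * pc j + 4 * ps j) + 3 * ps i * ps j"
  unfolding level_fun_def cos_sin_quarter_int gap_def by (simp_all add: pc_Suc ps_Suc algebra_simps)

text \<open>The value 2 does occur at \<open>i = j = 0\<close>: a cube with lowest layer -1 has a
  hyperplane that also touches a point of layer 0 outside the cube.\<close>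

lemma level_fun_2:
  assumes "m mod 4 = 2"
  shows "level_fun j i m \<ge> 2" "level_fun j i m = 2 \<Longrightarrow> i = 0 \<and> j = 0"
proof -
  have "pc i * pc j \<ge> pc i" "pc i * pc j \<ge> pc j" using pc_ge_1 by (auto simp: mult_le_cancel_left1 mult_le_cancel_right1 less_eq_real_def)
  moreover have "pc i * ps j \<ge> 0" "ps i * pc j \<ge> 0" "ps i * ps j \<ge> 0" using ps_ge_0 by (simp_all add: less_imp_le)
  moreover have eq: "level_fun j i m = 2 * (pc i * pc j) + pc i * ps j + 3 * (ps i * pc j) + 6 * (ps i * ps j)"
    using level_fun_cases(3)[OF assms] by (simp add: algebra_simps)
  ultimately have "level_fun j i m \<ge> 2 * pc i" "level_fun j i m \<ge> 2 * pc j" by linarith+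
  moreover have "pc k = 1 \<Longrightarrow> k = 0" for k using pc_inject[of k 0] by simp
  ultimately show "level_fun j i m \<ge> 2" "level_fun j i m = 2 \<Longrightarrow> i = 0 \<and> j = 0"
    using pc_ge_1[of i] pc_ge_1[of j] by fastforce+
qed

lemma level_fun_3:
  assumes "m mod 4 = 3"
  shows "level_fun j i m > 2"
proof -
  have "1 * 1 \<le> pc i * pc j" using pc_ge_1 by (intro mult_mono) (auto simp: less_imp_le)
  moreover have "pc i * ps j \<ge> 0" "ps i * ps j \<ge> 0" using ps_ge_0 by (simp_all add: less_imp_le)
  moreover have "level_fun j i m = 3 * (pc i * pc j) + 4 * (pc i * ps j) + 3 * (ps i * ps j)"
    using level_fun_cases(4)[OF assms] by (simp add: algebra_simps)
  ultimately show ?thesis by linarith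
qed

text \<open>Parity pairs the value 1 of \<open>gap\<close> with an odd \<open>d\<close>, where
  \<open>2 * cos\<close> is at most 1; in all other cases the hyperbolic term is at least 2. The
  first two alternatives for equality describe the cube vertices, the last one the stray
  contact.\<close>

lemma level_fun_bound:
  fixes m d :: int
  assumes "even (int i + int j + m + d)"
  shows "level_fun j i m - 2 * cos (of_int d * pi / 3) \<ge> 0"
    and "level_fun j i m - 2 * cos (of_int d * pi / 3) = 0 \<Longrightarrow>
      m mod 4 = 0 \<and> (i = Suc j \<and> d mod 6 \<in> {1, 5} \<or> (i = j \<or> i = Suc (Suc j)) \<and> d mod 6 = 0) \<or>
      m mod 4 = 1 \<and> (i = j \<and> d mod 6 \<in> {1, 5} \<or> (j = Suc i \<or> i = Suc j) \<and> d mod 6 = 0) \<or>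
      m mod 4 = 2 \<and> i = 0 \<and> j = 0"
    and "m mod 4 = 0 \<and> (i = Suc j \<and> d mod 6 \<in> {1, 5} \<or> (i = j \<or> i = Suc (Suc j)) \<and> d mod 6 = 0) \<or>
      m mod 4 = 1 \<and> (i = j \<and> d mod 6 \<in> {1, 5} \<or> (j = Suc i \<or> i = Suc j) \<and> d mod 6 = 0) \<Longrightarrow>
      level_fun j i m - 2 * cos (of_int d * pi / 3) = 0"
proof -
  define t where "t = 2 * cos (of_int d * pi / 3)"
  have t2: "t \<le> 2" by (simp add: t_def)
  have t1: "t \<le> 1" "t = 1 \<Longrightarrow> d mod 6 \<in> {1, 5}" if "odd d"
  proof -
    have "d mod 6 \<noteq> 0" "d mod 6 \<noteq> 2" "d mod 6 \<noteq> 4" using that by presburger+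
    then show "t \<le> 1" "t = 1 \<Longrightarrow> d mod 6 \<in> {1, 5}"
      unfolding t_def cos_third_int by (auto split: if_splits)
  qed
  have t20: "t = 2 \<Longrightarrow> d mod 6 = 0" unfolding t_def cos_third_int by (auto split: if_splits)
  consider "m mod 4 = 0" | "m mod 4 = 1" | "m mod 4 = 2" | "m mod 4 = 3"
    using pos_mod_bound[of 4 m] pos_mod_sign[of 4 m] by linarith
  then have "level_fun j i m - t \<ge> 0 \<and> (level_fun j i m - t = 0 \<longrightarrow>
      m mod 4 = 0 \<and> (i = Suc j \<and> d mod 6 \<in> {1, 5} \<or> (i = j \<or> i = Suc (Suc j)) \<and> d mod 6 = 0) \<or>
      m mod 4 = 1 \<and> (i = j \<and> d mod 6 \<in> {1, 5} \<or> (j = Suc i \<or> i = Suc j) \<and> d mod 6 = 0) \<or>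
      m mod 4 = 2 \<and> i = 0 \<and> j = 0)"
  proof cases
    case 1
    have lf: "level_fun j i m = gap i (Suc j)" using level_fun_cases(1)[OF 1] .
    consider "i = Suc j" | "i = j" | "i = Suc (Suc j)" | "i \<noteq> Suc j" "i \<noteq> j" "i \<noteq> Suc (Suc j)" by blast
    then show ?thesis
    proof cases
      case 1
      then have "odd d" using \<open>m mod 4 = 0\<close> assms by simp presburger
      then show ?thesis using lf 1 t1 \<open>m mod 4 = 0\<close> by auto
    next
      case 4
      then show ?thesis using lf gap_gt_2[of i "Suc j"] t2 by auto
    qed (use lf t2 t20 1 in auto)
  next
    case 2
    have lf: "level_fun j i m = gap i j" using level_fun_cases(2)[OF 2] .
    consider "i = j" | "j = Suc i" | "i = Suc j" | "i \<noteq> Suc j" "i \<noteq> j" "j \<noteq> Suc i" by blast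
    then show ?thesis
    proof cases
      case 1
      then have "odd d" using \<open>m mod 4 = 1\<close> assms by simp presburger
      then show ?thesis using lf 1 t1 \<open>m mod 4 = 1\<close> by auto
    next
      case 4
      then show ?thesis using lf gap_gt_2[of i j] t2 by auto
    qed (use lf t2 t20 2 in auto)
  next
    case 3
    then show ?thesis using level_fun_2[OF 3, of j i] t2 by auto
  next
    case 4
    then show ?thesis using level_fun_3[OF 4, of j i] t2 by auto
  qed
  then show "level_fun j i m - 2 * cos (of_int d * pi / 3) \<ge> 0" and "level_fun j i m - 2 * cos (of_int d * pi / 3) = 0 \<Longrightarrow>
      m mod 4 = 0 \<and> (i = Suc j \<and> d mod 6 \<in> {1, 5} \<or> (i = j \<or> i = Suc (Suc j)) \<and> d mod 6 = 0) \<or>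
      m mod 4 = 1 \<and> (i = j \<and> d mod 6 \<in> {1, 5} \<or> (j = Suc i \<or> i = Suc j) \<and> d mod 6 = 0) \<or>
      m mod 4 = 2 \<and> i = 0 \<and> j = 0" by (simp_all only: t_def)
  show "level_fun j i m - 2 * cos (of_int d * pi / 3) = 0" if
    "m mod 4 = 0 \<and> (i = Suc j \<and> d mod 6 \<in> {1, 5} \<or> (i = j \<or> i = Suc (Suc j)) \<and> d mod 6 = 0) \<or>
      m mod 4 = 1 \<and> (i = j \<and> d mod 6 \<in> {1, 5} \<or> (j = Suc i \<or> i = Suc j) \<and> d mod 6 = 0)"
    using that unfolding cos_third_int by (auto simp: level_fun_cases)
qed

section \<open>Layers of points on the 3-sphere\<close>

locale four_basis_vectors =
  fixes b0 b1 b2 b3 :: "'a::euclidean_space"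
  assumes basis: "{b0, b1, b2, b3} \<subseteq> Basis" and dist: "distinct [b0, b1, b2, b3]"
begin

lemma inner_basis [simp]:
  "b0 \<bullet> b0 = 1" "b1 \<bullet> b1 = 1" "b2 \<bullet> b2 = 1" "b3 \<bullet> b3 = 1"
  "b0 \<bullet> b1 = 0" "b0 \<bullet> b2 = 0" "b0 \<bullet> b3 = 0" "b1 \<bullet> b0 = 0" "b1 \<bullet> b2 = 0" "b1 \<bullet> b3 = 0"
  "b2 \<bullet> b0 = 0" "b2 \<bullet> b1 = 0" "b2 \<bullet> b3 = 0" "b3 \<bullet> b0 = 0" "b3 \<bullet> b1 = 0" "b3 \<bullet> b2 = 0"
  using basis dist by (auto simp: inner_not_same_Basis)

definition comb :: "real \<Rightarrow> real \<Rightarrow> real \<Rightarrow> real \<Rightarrow> 'a" where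
  "comb x y z u = x *\<^sub>R b0 + y *\<^sub>R b1 + z *\<^sub>R b2 + u *\<^sub>R b3"

lemma inner_comb: "comb x y z u \<bullet> comb x' y' z' u' = x * x' + y * y' + z * z' + u * u'"
  by (simp add: comb_def inner_add_left inner_add_right)

lemma comb_eq_iff: "comb x y z u = comb x' y' z' u' \<longleftrightarrow> x = x' \<and> y = y' \<and> z = z' \<and> u = u'"
proof
  assume eq: "comb x y z u = comb x' y' z' u'"
  have "comb x y z u \<bullet> comb p q r s = comb x' y' z' u' \<bullet> comb p q r s" for p q r s using eq by simp
  from this[of 1 0 0 0] this[of 0 1 0 0] this[of 0 0 1 0] this[of 0 0 0 1]
  show "x = x' \<and> y = y' \<and> z = z' \<and> u = u'" by (simp add: inner_comb)
qed simp

lemma comb_linear: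
  "comb x y z u + comb x' y' z' u' = comb (x + x') (y + y') (z + z') (u + u')"
  "comb x y z u - comb x' y' z' u' = comb (x - x') (y - y') (z - z') (u - u')"
  "c *\<^sub>R comb x y z u = comb (c * x) (c * y) (c * z) (c * u)"
  by (simp_all add: comb_def algebra_simps)

text \<open>Together with the omitted coordinate \<open>2 * pc i\<close>, the first two coordinates are $\sqrt 3$ times a
  point of the hyperboloid model, at distance \<open>i * arcosh 2\<close> from the midpoint of the \<open>n\<close>-th side of the
  quadrilateral; the last two give the angle $k\pi/3$ on the circle.\<close>

definition hpt :: "nat \<Rightarrow> int \<Rightarrow> int \<Rightarrow> 'a" where
  "hpt i n k = comb
     (pc i * cos (of_int n * pi / 2) - 3 * ps i * sin (of_int n * pi / 2))
     (pc i * sin (of_int n * pi / 2) + 3 * ps i * cos (of_int n * pi / 2))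
     (sqrt 3 * cos (of_int k * pi / 3)) (sqrt 3 * sin (of_int k * pi / 3))"

definition pt :: "nat \<Rightarrow> int \<Rightarrow> int \<Rightarrow> 'a" where
  "pt i n k = (1 / (2 * pc i)) *\<^sub>R hpt i n k"

lemma hpt_eq_pt: "hpt i n k = (2 * pc i) *\<^sub>R pt i n k"
  by (simp add: pt_def)

lemma inner_hpt:
  "hpt i n k \<bullet> hpt i' n' k' =
    (pc i * pc i' + 9 * ps i * ps i') * cos (of_int (n - n') * pi / 2) +
    3 * (pc i * ps i' - ps i * pc i') * sin (of_int (n - n') * pi / 2) + 3 * cos (of_int (k - k') * pi / 3)"
proof -
  have n: "of_int (n - n') * pi / 2 = of_int n * pi / 2 - of_int n' * pi / 2"
    and k: "of_int (k - k') * pi / 3 = of_int k * pi / 3 - of_int k' * pi / 3"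
    by (simp_all add: algebra_simps diff_divide_distrib)
  have "(c * x - 3 * s * y) * (c' * x' - 3 * s' * y') + (c * y + 3 * s * x) * (c' * y' + 3 * s' * x') +
      sqrt 3 * z * (sqrt 3 * z') + sqrt 3 * u * (sqrt 3 * u') =
    (c * c' + 9 * s * s') * (x * x' + y * y') + 3 * (c * s' - s * c') * (y * x' - x * y') + 3 * (z * z' + u * u')"
    for c c' s s' x x' y y' z z' u u' :: real
  proof -
    have "sqrt 3 * z * (sqrt 3 * z') = 3 * (z * z')" "sqrt 3 * u * (sqrt 3 * u') = 3 * (u * u')" by simp_all
    then show ?thesis by (simp only:) (simp add: algebra_simps)
  qed
  then show ?thesis unfolding n k cos_diff sin_diff hpt_def inner_comb by (simp only:)
qed

text \<open>Pell's equation turns \<open>pc^2 + 9 * ps^2 + 3\<close> into \<open>4 * pc^2\<close>,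
  which explains the divisor \<open>2 * pc i\<close> in \<open>pt\<close>.\<close>

lemma norm_pt: "norm (pt i n k) = 1"
proof -
  have "hpt i n k \<bullet> hpt i n k = (2 * pc i)\<^sup>2"
    using pell[of i] by (simp add: inner_hpt power2_eq_square algebra_simps)
  then have "norm (hpt i n k) = 2 * pc i"
    by (simp add: norm_eq_sqrt_inner real_sqrt_mult less_imp_le)
  then show ?thesis by (simp add: pt_def less_imp_le)
qed

lemma pt_cong:
  assumes "n mod 4 = n' mod 4" "k mod 6 = k' mod 6"
  shows "pt i n k = pt i n' k'"
proof -
  have n: "n = n' + 4 * ((n - n') div 4)" using assms(1) by (simp add: mod_eq_dvd_iff)
  have k: "k = k' + 6 * ((k - k') div 6)" using assms(2) by (simp add: mod_eq_dvd_iff)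
  have n2: "of_int n * pi / 2 = of_int n' * pi / 2 + (2 * pi) * of_int ((n - n') div 4)"
    by (subst n) (simp add: algebra_simps)
  have k2: "of_int k * pi / 3 = of_int k' * pi / 3 + (2 * pi) * of_int ((k - k') div 6)"
    by (subst k) (simp add: algebra_simps)
  show ?thesis
    unfolding pt_def hpt_def n2 k2 sin_add cos_add sin_int_2pin cos_int_2pin by simp
qed

text \<open>The circle part has squared length \<open>3 / (4 * pc^2)\<close>, which recovers
  \<open>i\<close>. The inner product then has to attain its maximum in both angles.\<close>

lemma pt_eqD:
  assumes "pt i n k = pt i' n' k'"
  shows "i = i'" "n mod 4 = n' mod 4" "k mod 6 = k' mod 6"
proof -
  have inner_sqrt: "(comb 0 0 1 0 \<bullet> pt i n k)\<^sup>2 + (comb 0 0 0 1 \<bullet> pt i n k)\<^sup>2 = 3 / (4 * (pc i)\<^sup>2)" for i n k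
  proof -
    have "(comb 0 0 1 0 \<bullet> pt i n k)\<^sup>2 + (comb 0 0 0 1 \<bullet> pt i n k)\<^sup>2
        = 3 * (cos (of_int k * pi / 3))\<^sup>2 / (4 * (pc i)\<^sup>2) + 3 * (sin (of_int k * pi / 3))\<^sup>2 / (4 * (pc i)\<^sup>2)"
      by (simp add: pt_def hpt_def inner_comb power_mult_distrib power_divide)
    also have "\<dots> = 3 * ((cos (of_int k * pi / 3))\<^sup>2 + (sin (of_int k * pi / 3))\<^sup>2) / (4 * (pc i)\<^sup>2)"
      by (simp only: distrib_left add_divide_distrib)
    finally show ?thesis by (simp only: sin_cos_squared_add2 mult_1_right)
  qed
  have "3 / (4 * (pc i)\<^sup>2) = 3 / (4 * (pc i')\<^sup>2)" using inner_sqrt[of i n k] inner_sqrt[of i' n' k'] assms by simp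
  then have "(pc i)\<^sup>2 = (pc i')\<^sup>2" by (simp add: field_simps)
  then have "pc i = pc i'" using pc_pos[of i] pc_pos[of i'] by (simp add: power2_eq_iff)
  then show i: "i = i'" by (rule pc_inject)
  then have "hpt i n k = hpt i n' k'" using assms by (simp add: hpt_eq_pt)
  then have eq: "(hpt i n k - hpt i n' k') = 0" by simp
  let ?n = "cos (of_int (n - n') * pi / 2)" and ?k = "cos (of_int (k - k') * pi / 3)"
  have "hpt i n k \<bullet> hpt i n' k' = hpt i n k \<bullet> hpt i n k" using eq by simp
  then have *: "((pc i)\<^sup>2 + 9 * (ps i)\<^sup>2) * (1 - ?n) + 3 * (1 - ?k) = 0"
    unfolding inner_hpt by (simp add: power2_eq_square algebra_simps)
  have "((pc i)\<^sup>2 + 9 * (ps i)\<^sup>2) > 0" by (simp add: add_pos_nonneg)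
  moreover have "1 - ?n \<ge> 0" "1 - ?k \<ge> 0" by simp_all
  ultimately have "1 - ?k = 0" "1 - ?n = 0"
    using * by (smt (verit) mult_nonneg_nonneg mult_pos_pos)+
  then have "?k = 1" "?n = 1" by simp_all
  then have "(k - k') mod 6 = 0" "(n - n') mod 4 = 0"
    using cos_third_int[of "k - k'"] cos_sin_quarter_int(1)[of "n - n'"] by (auto split: if_splits)
  then show "n mod 4 = n' mod 4" "k mod 6 = k' mod 6" by (simp_all add: mod_eq_dvd_iff dvd_eq_mod_eq_0)
qed

lemma pt_eq_iff: "pt i n k = pt i' n' k' \<longleftrightarrow> i = i' \<and> n mod 4 = n' mod 4 \<and> k mod 6 = k' mod 6"
  using pt_eqD[of i n k i' n' k'] pt_cong by blast

text \<open>The hyperbolic part is forced by prescribing \<open>gap i (Suc j)\<close> on geodesic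
  \<open>n\<close> and \<open>gap i j\<close> on geodesic \<open>n + 1\<close>. The circle part
  turns the factor \<open>sqrt 3\<close> of \<open>hpt\<close> into
  \<open>- 2 * cos\<close>.\<close>

definition cube_normal :: "int \<Rightarrow> nat \<Rightarrow> int \<Rightarrow> 'a" where
  "cube_normal n j k = comb
     (ps j * cos (of_int n * pi / 2) + (pc j + 2 * ps j) * sin (of_int n * pi / 2))
     (ps j * sin (of_int n * pi / 2) - (pc j + 2 * ps j) * cos (of_int n * pi / 2))
     (- 2 / sqrt 3 * cos (of_int k * pi / 3)) (- 2 / sqrt 3 * sin (of_int k * pi / 3))"

text \<open>Scaling by \<open>2 * pc i\<close> homogenizes: the constant term pairs with the omitted
  hyperboloid coordinate. The factor is positive, so signs and zeros carry over.\<close>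

lemma cube_functional:
  "2 * pc i * (cube_normal n0 j k0 \<bullet> pt i n k + (pc j + ps j)) =
    level_fun j i (n - n0) - 2 * cos (of_int (k - k0) * pi / 3)"
proof -
  have n: "of_int (n - n') * pi / 2 = of_int n * pi / 2 - of_int n' * pi / 2" for n n'
    by (simp add: algebra_simps diff_divide_distrib)
  have k: "of_int (k - k') * pi / 3 = of_int k * pi / 3 - of_int k' * pi / 3" for k k'
    by (simp add: algebra_simps diff_divide_distrib)
  have identity: "(s' * x' + (c' + 2 * s') * y') * (c * x - 3 * s * y) +
      (s' * y' - (c' + 2 * s') * x') * (c * y + 3 * s * x) +
      - 2 / sqrt 3 * z' * (sqrt 3 * z) + - 2 / sqrt 3 * u' * (sqrt 3 * u) + h =
    s' * (c * (x * x' + y * y') - 3 * s * (y * x' - x * y')) -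
      (c' + 2 * s') * (c * (y * x' - x * y') + 3 * s * (x * x' + y * y')) + h - 2 * (z * z' + u * u')"
    for c c' s s' x x' y y' z z' u u' h :: real
  proof -
    have "- 2 / sqrt 3 * z' * (sqrt 3 * z) = - 2 * (z * z')" "- 2 / sqrt 3 * u' * (sqrt 3 * u) = - 2 * (u * u')"
      by simp_all
    then show ?thesis by (simp only:) (simp add: algebra_simps)
  qed
  have "2 * pc i * (cube_normal n0 j k0 \<bullet> pt i n k + (pc j + ps j)) =
      cube_normal n0 j k0 \<bullet> hpt i n k + (pc j + ps j) * (2 * pc i)"
    by (simp add: pt_def field_simps)
  also have "\<dots> = level_fun j i (n - n0) - 2 * cos (of_int (k - k0) * pi / 3)"
    unfolding level_fun_def n k cos_diff sin_diff hpt_def cube_normal_def inner_comb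
    by (rule identity)
  finally show ?thesis .
qed

text \<open>The parity encodes the alternation of roots of unity. It is invariant under the three
  lattice steps, and well defined because \<open>n\<close> counts modulo 4 and \<open>k\<close>
  modulo 6.\<close>

definition pts :: "nat set \<Rightarrow> 'a set" where
  "pts I = {pt i n k | i n k. i \<in> I \<and> even (int i + n + k)}"

text \<open>These unit vectors lie on the same sphere as the layers, so the pyramids stay
  inscribed.\<close>

definition apexes :: "'a set" where "apexes = Basis - {b0, b1, b2, b3}"

definition verts :: "nat \<Rightarrow> 'a set" where "verts N = pts {..N} \<union> apexes"

lemma ptsI: "i \<in> I \<Longrightarrow> even (int i + n + k) \<Longrightarrow> pt i n k \<in> pts I"
  by (auto simp: pts_def)

lemma pts_eq_image:
  "pts I = (\<lambda>(i, n, r). pt i n (2 * r + (int i + n) mod 2)) ` (I \<times> {0..<4} \<times> {0..<3})"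
proof
  show "pts I \<subseteq> (\<lambda>(i, n, r). pt i n (2 * r + (int i + n) mod 2)) ` (I \<times> {0..<4} \<times> {0..<3})"
  proof
    fix x assume "x \<in> pts I"
    then obtain i n k where x: "i \<in> I" "even (int i + n + k)" "x = pt i n k" by (auto simp: pts_def)
    have "k mod 6 = 2 * (k mod 6 div 2) + (int i + n mod 4) mod 2" using x(2) by presburger
    moreover have "pt i n k = pt i (n mod 4) (k mod 6)" by (rule pt_cong) auto
    ultimately have "x = (\<lambda>(i, n, r). pt i n (2 * r + (int i + n) mod 2)) (i, n mod 4, k mod 6 div 2)"
      using x(3) by simp
    moreover have "k mod 6 div 2 \<in> {0..<3}" by auto
    ultimately show "x \<in> (\<lambda>(i, n, r). pt i n (2 * r + (int i + n) mod 2)) ` (I \<times> {0..<4} \<times> {0..<3})"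
      using x(1) by (intro image_eqI[where x = "(i, n mod 4, k mod 6 div 2)"]) auto
  qed
  show "(\<lambda>(i, n, r). pt i n (2 * r + (int i + n) mod 2)) ` (I \<times> {0..<4} \<times> {0..<3}) \<subseteq> pts I"
    by (auto intro!: ptsI)
qed

lemma finite_pts: "finite I \<Longrightarrow> finite (pts I)"
  by (simp add: pts_eq_image)

lemma card_pts: "card (pts I) = 12 * card I"
proof -
  have "inj_on (\<lambda>(i, n, r). pt i n (2 * r + (int i + n) mod 2)) (I \<times> {0..<4} \<times> {0..<3})"
  proof (rule inj_onI)
    fix x y
    assume "x \<in> I \<times> {0..<4} \<times> {0..<3}" "y \<in> I \<times> {0..<4} \<times> {0..<3}"
      and eq: "(\<lambda>(i, n, r). pt i n (2 * r + (int i + n) mod 2)) x = (\<lambda>(i, n, r). pt i n (2 * r + (int i + n) mod 2)) y"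
    then obtain i n r i' n' r' where x: "x = (i, n, r)" "0 \<le> n" "n < 4" "0 \<le> r" "r < 3"
      and y: "y = (i', n', r')" "0 \<le> n'" "n' < 4" "0 \<le> r'" "r' < 3" by auto
    have "pt i n (2 * r + (int i + n) mod 2) = pt i' n' (2 * r' + (int i' + n') mod 2)"
      using eq x(1) y(1) by simp
    note D = pt_eqD[OF this]
    have n: "n = n'" using D(2) x y by simp
    have "(int i + n) mod 2 \<ge> 0" "(int i + n) mod 2 < 2" by simp_all
    then have "2 * r + (int i + n) mod 2 = 2 * r' + (int i + n) mod 2"
      using D(3) x y unfolding D(1)[symmetric] n[symmetric] by (subst (asm) (1 2) mod_pos_pos_trivial) linarith+
    then show "x = y" using D(1) n x(1) y(1) by simp
  qed
  then show ?thesis by (simp add: pts_eq_image card_image card_cartesian_product)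
qed

lemma comb_inner_apex: "x \<in> apexes \<Longrightarrow> comb p q r s \<bullet> x = 0"
  using basis by (auto simp: apexes_def comb_def inner_add_left inner_not_same_Basis)

lemma pt_inner_apex: "x \<in> apexes \<Longrightarrow> pt i n k \<bullet> x = 0"
  by (simp add: pt_def hpt_def comb_inner_apex)

lemma finite_apexes: "finite apexes"
  by (simp add: apexes_def)

lemma card_apexes: "card apexes = DIM('a) - 4"
  using basis dist by (simp add: apexes_def card_Diff_subset)

lemma pts_Int_apexes: "pts I \<inter> apexes = {}"
proof -
  have "x \<notin> apexes" if x: "x \<in> pts I" for x
  proof
    assume "x \<in> apexes"
    obtain i n k where "x = pt i n k" using x unfolding pts_def by blast
    then have "x \<bullet> x = 0" using pt_inner_apex[OF \<open>x \<in> apexes\<close>, of i n k] by simp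
    then show False using \<open>x \<in> apexes\<close> by (auto simp: apexes_def)
  qed
  then show ?thesis by blast
qed

lemma finite_verts: "finite (verts N)"
  by (simp add: verts_def finite_pts finite_apexes)

lemma DIM_ge_4: "DIM('a) \<ge> 4"
proof -
  have "card {b0, b1, b2, b3} \<le> DIM('a)" using basis by (intro card_mono) auto
  then show ?thesis using dist by simp
qed

lemma card_verts: "card (verts N) = 12 * (N + 1) + DIM('a) - 4"
  using card_Un_disjoint[OF finite_pts[of "{..N}"] finite_apexes pts_Int_apexes[of "{..N}"]] DIM_ge_4
  by (simp add: verts_def card_pts card_apexes)

lemma verts_sphere: "verts N \<subseteq> sphere 0 1"
  by (auto simp: verts_def pts_def apexes_def norm_pt)

section \<open>Faces of the polytopes\<close>

text \<open>The sum of two nonnegative functionals vanishes exactly where both do. The normals have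
  no component along the apexes, where the constant \<open>pc j + ps j\<close> keeps the value
  positive.\<close>

lemma two_cubes_face:
  assumes "T \<subseteq> verts N" "even (int j + n0 + k0)" "even (int j' + n0' + k0')"
    and T: "\<And>i n k. i \<le> N \<Longrightarrow> even (int i + n + k) \<Longrightarrow> pt i n k \<in> T \<longleftrightarrow>
      level_fun j i (n - n0) - 2 * cos (of_int (k - k0) * pi / 3) = 0 \<and>
      level_fun j' i (n - n0') - 2 * cos (of_int (k - k0') * pi / 3) = 0"
    and "T \<inter> apexes = {}"
  shows "convex hull T face_of convex hull (verts N)" "verts N \<inter> convex hull T = T"
proof -
  let ?f = "\<lambda>x. cube_normal n0 j k0 \<bullet> x + (pc j + ps j)" and ?g = "\<lambda>x. cube_normal n0' j' k0' \<bullet> x + (pc j' + ps j')"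
  have cube: "cube_normal n0 j k0 \<bullet> pt i n k + (pc j + ps j) \<ge> 0"
    "cube_normal n0 j k0 \<bullet> pt i n k + (pc j + ps j) = 0 \<longleftrightarrow>
      level_fun j i (n - n0) - 2 * cos (of_int (k - k0) * pi / 3) = 0"
    if "even (int j + n0 + k0)" "even (int i + n + k)" for n0 j k0 i n k
  proof -
    have "even (int i + int j + (n - n0) + (k - k0))" using that by presburger
    then show "cube_normal n0 j k0 \<bullet> pt i n k + (pc j + ps j) \<ge> 0"
      using level_fun_bound(1)[of i j "n - n0" "k - k0"] cube_functional[of i n0 j k0 n k] pc_pos[of i]
      by (metis mult_pos_pos zero_le_mult_iff zero_less_numeral not_less)
    show "cube_normal n0 j k0 \<bullet> pt i n k + (pc j + ps j) = 0 \<longleftrightarrow>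
      level_fun j i (n - n0) - 2 * cos (of_int (k - k0) * pi / 3) = 0"
      unfolding cube_functional[symmetric] by simp
  qed
  have apex: "cube_normal n0 j k0 \<bullet> x + (pc j + ps j) > 0" if "x \<in> apexes" for n0 j k0 x
    using comb_inner_apex[OF that] ps_ge_0[of j] by (simp add: cube_normal_def add_pos_nonneg)
  let ?a = "cube_normal n0 j k0 + cube_normal n0' j' k0'" and ?b = "(pc j + ps j) + (pc j' + ps j')"
  have sum: "?a \<bullet> x + ?b = ?f x + ?g x" for x by (simp add: inner_add_left)
  have nonneg: "?f x \<ge> 0 \<and> ?g x \<ge> 0" if "x \<in> verts N" for x
  proof (cases "x \<in> apexes")
    case True
    then show ?thesis using apex[of x n0 j k0] apex[of x n0' j' k0'] by linarith
  next
    case False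
    then have "x \<in> pts {..N}" using that by (simp add: verts_def)
    then obtain i n k where "even (int i + n + k)" "x = pt i n k" unfolding pts_def by blast
    then show ?thesis using cube(1)[OF assms(2)] cube(1)[OF assms(3)] by blast
  qed
  have zero: "?a \<bullet> x + ?b = 0 \<longleftrightarrow> x \<in> T" if x: "x \<in> verts N" for x
  proof (cases "x \<in> apexes")
    case True
    then show ?thesis unfolding sum using apex[of x n0 j k0] apex[of x n0' j' k0'] assms(5) by force
  next
    case False
    then have "x \<in> pts {..N}" using x by (simp add: verts_def)
    then obtain i n k where i: "i \<le> N" "even (int i + n + k)" "x = pt i n k"
      unfolding pts_def by blast
    have "?a \<bullet> x + ?b = 0 \<longleftrightarrow> ?f x = 0 \<and> ?g x = 0" unfolding sum using nonneg[OF x] by linarith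
    also have "\<dots> \<longleftrightarrow> x \<in> T" unfolding i(3) T[OF i(1,2)] cube(2)[OF assms(2) i(2)] cube(2)[OF assms(3) i(2)] ..
    finally show ?thesis .
  qed
  have nn: "?a \<bullet> x + ?b \<ge> 0" if "x \<in> verts N" for x unfolding sum using nonneg[OF that] by linarith
  show "convex hull T face_of convex hull (verts N)" "verts N \<inter> convex hull T = T"
    using supporting_functional_face[OF finite_verts nn zero assms(1)] by auto
qed

lemma pt_shift_eqs:
  "pt i' (n + m) (k + d) = pt i n k \<longleftrightarrow> i' = i \<and> m mod 4 = 0 \<and> d mod 6 = 0"
  "pt i' (n + m) (k + d) = pt i (n + 1) k \<longleftrightarrow> i' = i \<and> m mod 4 = 1 \<and> d mod 6 = 0"
  "pt i' (n + m) (k + d) = pt i n (k + e) \<longleftrightarrow> i' = i \<and> m mod 4 = 0 \<and> d mod 6 = e mod 6"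
  "pt i' (n + m) (k + d) = pt i (n + 1) (k + e) \<longleftrightarrow> i' = i \<and> m mod 4 = 1 \<and> d mod 6 = e mod 6"
proof -
  have n: "(n + m) mod 4 = n mod 4 \<longleftrightarrow> m mod 4 = 0" "(n + m) mod 4 = (n + 1) mod 4 \<longleftrightarrow> m mod 4 = 1"
    by presburger+
  have k: "(k + d) mod 6 = k mod 6 \<longleftrightarrow> d mod 6 = 0" "(k + d) mod 6 = (k + e) mod 6 \<longleftrightarrow> d mod 6 = e mod 6"
    by (simp_all add: mod_eq_dvd_iff dvd_eq_mod_eq_0)
  show "pt i' (n + m) (k + d) = pt i n k \<longleftrightarrow> i' = i \<and> m mod 4 = 0 \<and> d mod 6 = 0"
    "pt i' (n + m) (k + d) = pt i (n + 1) k \<longleftrightarrow> i' = i \<and> m mod 4 = 1 \<and> d mod 6 = 0"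
    "pt i' (n + m) (k + d) = pt i n (k + e) \<longleftrightarrow> i' = i \<and> m mod 4 = 0 \<and> d mod 6 = e mod 6"
    "pt i' (n + m) (k + d) = pt i (n + 1) (k + e) \<longleftrightarrow> i' = i \<and> m mod 4 = 1 \<and> d mod 6 = e mod 6"
    by (simp_all only: pt_eq_iff n k)
qed

text \<open>The lattice square of the first two unit vectors, with top vertex in layer
  \<open>i + 2\<close>; it stays over one geodesic.\<close>

definition flat_square :: "nat \<Rightarrow> int \<Rightarrow> int \<Rightarrow> 'a set" where
  "flat_square i n k = {pt (Suc (Suc i)) n k, pt (Suc i) n (k + (- 1)), pt (Suc i) n (k + 1), pt i n k}"

text \<open>The square of the third unit vector and one of the first two; \<open>e\<close>, being 1
  or -1, selects which.\<close>

definition steep_square :: "int \<Rightarrow> nat \<Rightarrow> int \<Rightarrow> int \<Rightarrow> 'a set" where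
  "steep_square e i n k = {pt (Suc (Suc i)) n k, pt (Suc i) n (k + e), pt (Suc i) (n + 1) k, pt i (n + 1) (k + e)}"

lemma squares_subset:
  assumes "Suc (Suc i) \<le> N" "even (int i + n + k)" "odd e"
  shows "flat_square i n k \<subseteq> pts {..N}" "steep_square e i n k \<subseteq> pts {..N}"
  using assms by (auto simp: flat_square_def steep_square_def intro!: ptsI)

lemma flat_square_face:
  assumes N: "Suc (Suc i) \<le> N" and par: "even (int i + n + k)"
  shows "convex hull flat_square i n k face_of convex hull (verts N)"
    "verts N \<inter> convex hull flat_square i n k = flat_square i n k"
proof -
  have sub: "flat_square i n k \<subseteq> pts {..N}" using squares_subset[OF N par, of 1] by simp
  \<comment> \<open>The square is the upper square of one cube and the lower square of the cube at
    \<open>n - 1\<close>, \<open>Suc i\<close>, hence the shift to \<open>m + 1\<close>. The second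
    cube may extend beyond layer \<open>N\<close>; its functional still supports.\<close>
  have iff: "pt i' (n + m) (k + d) \<in> flat_square i n k \<longleftrightarrow>
      level_fun i i' m - 2 * cos (of_int d * pi / 3) = 0 \<and>
      level_fun (Suc i) i' (m + 1) - 2 * cos (of_int d * pi / 3) = 0"
    if "even (int i' + (n + m) + (k + d))" for i' m d
  proof -
    have p: "even (int i' + int i + m + d)" "even (int i' + int (Suc i) + (m + 1) + d)"
      using that par by presburger+
    have m4: "m mod 4 = 0 \<longleftrightarrow> (m + 1) mod 4 = 1" "m mod 4 = 1 \<longleftrightarrow> (m + 1) mod 4 = 2"
      "m mod 4 = 2 \<longleftrightarrow> (m + 1) mod 4 = 3" by presburger+
    have T: "pt i' (n + m) (k + d) \<in> flat_square i n k \<longleftrightarrow> m mod 4 = 0 \<and>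
        (i' = Suc i \<and> d mod 6 \<in> {1, 5} \<or> (i' = i \<or> i' = Suc (Suc i)) \<and> d mod 6 = 0)"
      unfolding flat_square_def insert_iff empty_iff pt_shift_eqs by auto
    show ?thesis
    proof
      assume "pt i' (n + m) (k + d) \<in> flat_square i n k"
      then have z: "m mod 4 = 0" "i' = Suc i \<and> d mod 6 \<in> {1, 5} \<or> (i' = i \<or> i' = Suc (Suc i)) \<and> d mod 6 = 0"
        unfolding T by simp_all
      then have "(m + 1) mod 4 = 1" using m4 by simp
      then show "level_fun i i' m - 2 * cos (of_int d * pi / 3) = 0 \<and>
          level_fun (Suc i) i' (m + 1) - 2 * cos (of_int d * pi / 3) = 0"
        using z(2) by (intro conjI level_fun_bound(3)[OF p(1)] level_fun_bound(3)[OF p(2)]) (use z in auto)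
    next
      assume z: "level_fun i i' m - 2 * cos (of_int d * pi / 3) = 0 \<and>
          level_fun (Suc i) i' (m + 1) - 2 * cos (of_int d * pi / 3) = 0"
      \<comment> \<open>The second cube has positive index, hence no stray contact. This rules out
        the lower square of the first cube as well as the latter's stray contact.\<close>
      have "(m + 1) mod 4 = 0 \<or> (m + 1) mod 4 = 1"
        using level_fun_bound(2)[OF p(2)] z by linarith
      then have "m mod 4 \<noteq> 1" "m mod 4 \<noteq> 2" using m4 by auto
      then show "pt i' (n + m) (k + d) \<in> flat_square i n k"
        unfolding T using level_fun_bound(2)[OF p(1)] z by linarith
    qed
  qed
  have iff': "pt i' n' k' \<in> flat_square i n k \<longleftrightarrow>
      level_fun i i' (n' - n) - 2 * cos (of_int (k' - k) * pi / 3) = 0 \<and>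
      level_fun (Suc i) i' (n' - (n - 1)) - 2 * cos (of_int (k' - k) * pi / 3) = 0"
    if "i' \<le> N" "even (int i' + n' + k')" for i' n' k'
    using iff[of i' "n' - n" "k' - k"] that by (simp add: algebra_simps)
  have par': "even (int (Suc i) + (n - 1) + k)" using par by simp
  have sub': "flat_square i n k \<subseteq> verts N" "flat_square i n k \<inter> apexes = {}"
    using sub pts_Int_apexes[of "{..N}"] unfolding verts_def by blast+
  show "convex hull flat_square i n k face_of convex hull (verts N)"
    by (rule two_cubes_face(1)[OF sub'(1) par par' iff' sub'(2)])
  show "verts N \<inter> convex hull flat_square i n k = flat_square i n k"
    by (rule two_cubes_face(2)[OF sub'(1) par par' iff' sub'(2)])
qed

lemma steep_square_face:
  assumes N: "Suc (Suc i) \<le> N" and par: "even (int i + n + k)" and e: "e \<in> {1, - 1}"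
  shows "convex hull steep_square e i n k face_of convex hull (verts N)"
    "verts N \<inter> convex hull steep_square e i n k = steep_square e i n k"
proof -
  have sub: "steep_square e i n k \<subseteq> pts {..N}" using squares_subset[OF N par, of e] e by auto
  \<comment> \<open>Here the two cubes are translates by a lattice step along the geodesic with a
    change of angle \<open>e\<close>.\<close>
  have iff: "pt i' (n + m) (k + d) \<in> steep_square e i n k \<longleftrightarrow>
      level_fun i i' m - 2 * cos (of_int d * pi / 3) = 0 \<and>
      level_fun (Suc i) i' m - 2 * cos (of_int (d - e) * pi / 3) = 0"
    if "even (int i' + (n + m) + (k + d))" for i' m d
  proof -
    have "odd e" using e by auto
    then have p: "even (int i' + int i + m + d)" "even (int i' + int (Suc i) + m + (d - e))"
      using that par by presburger+
    have d6: "d mod 6 = e mod 6 \<longleftrightarrow> (d - e) mod 6 = 0" "d mod 6 = 0 \<Longrightarrow> (d - e) mod 6 \<in> {1, 5}"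
      "(d - e) mod 6 = 0 \<Longrightarrow> d mod 6 \<in> {1, 5}"
      using e by (elim insertE emptyE; simp; presburger)+
    have T: "pt i' (n + m) (k + d) \<in> steep_square e i n k \<longleftrightarrow>
        m mod 4 = 0 \<and> (i' = Suc (Suc i) \<and> d mod 6 = 0 \<or> i' = Suc i \<and> (d - e) mod 6 = 0) \<or>
        m mod 4 = 1 \<and> (i' = Suc i \<and> d mod 6 = 0 \<or> i' = i \<and> (d - e) mod 6 = 0)"
      unfolding steep_square_def insert_iff empty_iff pt_shift_eqs d6(1) by auto
    show ?thesis
    proof
      assume "pt i' (n + m) (k + d) \<in> steep_square e i n k"
      then show "level_fun i i' m - 2 * cos (of_int d * pi / 3) = 0 \<and>
          level_fun (Suc i) i' m - 2 * cos (of_int (d - e) * pi / 3) = 0"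
        unfolding T using d6(2,3)
        by (intro conjI level_fun_bound(3)[OF p(1)] level_fun_bound(3)[OF p(2)]) auto
    next
      assume z: "level_fun i i' m - 2 * cos (of_int d * pi / 3) = 0 \<and>
          level_fun (Suc i) i' m - 2 * cos (of_int (d - e) * pi / 3) = 0"
      show "pt i' (n + m) (k + d) \<in> steep_square e i n k"
        unfolding T
        using level_fun_bound(2)[OF p(1) conjunct1[OF z]] level_fun_bound(2)[OF p(2) conjunct2[OF z]] by auto
    qed
  qed
  have iff': "pt i' n' k' \<in> steep_square e i n k \<longleftrightarrow>
      level_fun i i' (n' - n) - 2 * cos (of_int (k' - k) * pi / 3) = 0 \<and>
      level_fun (Suc i) i' (n' - n) - 2 * cos (of_int (k' - (k + e)) * pi / 3) = 0"
    if "i' \<le> N" "even (int i' + n' + k')" for i' n' k'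
    using iff[of i' "n' - n" "k' - k"] that by (simp add: algebra_simps)
  have par': "even (int (Suc i) + n + (k + e))" using par e by auto
  have sub': "steep_square e i n k \<subseteq> verts N" "steep_square e i n k \<inter> apexes = {}"
    using sub pts_Int_apexes[of "{..N}"] unfolding verts_def by blast+
  show "convex hull steep_square e i n k face_of convex hull (verts N)"
    by (rule two_cubes_face(1)[OF sub'(1) par par' iff' sub'(2)])
  show "verts N \<inter> convex hull steep_square e i n k = steep_square e i n k"
    by (rule two_cubes_face(2)[OF sub'(1) par par' iff' sub'(2)])
qed

text \<open>A linear relation between the \<open>hpt\<close> that also holds in the omitted
  coordinate becomes an affine relation after division by it.\<close>

lemma aff_dim_hpt_lincomb_le_2:
  assumes "hpt i n k = x *\<^sub>R hpt i1 n1 k1 + y *\<^sub>R hpt i2 n2 k2 + z *\<^sub>R hpt i3 n3 k3"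
    and "pc i = x * pc i1 + y * pc i2 + z * pc i3"
  shows "aff_dim {pt i n k, pt i1 n1 k1, pt i2 n2 k2, pt i3 n3 k3} \<le> 2"
proof (rule aff_dim_four_points_le_2)
  show "pt i n k = (x * pc i1 / pc i) *\<^sub>R pt i1 n1 k1 + (y * pc i2 / pc i) *\<^sub>R pt i2 n2 k2
      + (z * pc i3 / pc i) *\<^sub>R pt i3 n3 k3"
    unfolding pt_def[of i] assms(1) by (simp add: hpt_eq_pt scaleR_add_right field_simps)
  show "x * pc i1 / pc i + y * pc i2 / pc i + z * pc i3 / pc i = 1"
    by (simp add: assms(2)[symmetric] flip: add_divide_distrib)
qed

lemma aff_dim_flat_square: "aff_dim (flat_square i n k) \<le> 2"
  unfolding flat_square_def
\<comment> \<open>The coefficients combine \<open>pc (i + 2) = 4 * pc (i + 1) - pc i\<close> with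
  the fact that the sixth roots of unity on both sides of a given one sum to it.\<close>
proof (rule aff_dim_hpt_lincomb_le_2[where x = 2 and y = 2 and z = "- 1"])
  have k: "of_int (k + - 1) * pi / 3 = of_int k * pi / 3 - pi / 3"
    "of_int (k + 1) * pi / 3 = of_int k * pi / 3 + pi / 3"
    by (simp_all add: algebra_simps add_divide_distrib diff_divide_distrib)
  show "hpt (Suc (Suc i)) n k = 2 *\<^sub>R hpt (Suc i) n (k + - 1) + 2 *\<^sub>R hpt (Suc i) n (k + 1) + - 1 *\<^sub>R hpt i n k"
    unfolding hpt_def comb_linear comb_eq_iff k cos_add cos_diff sin_add sin_diff cos_60 sin_60
    by (simp add: pc_Suc ps_Suc algebra_simps)
  show "pc (Suc (Suc i)) = 2 * pc (Suc i) + 2 * pc (Suc i) + - 1 * pc i"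
    by (simp add: pc_Suc ps_Suc)
qed

text \<open>Edges in the third lattice direction are orthogonal to the mirror of the reflection, so
  their direction depends only on \<open>n\<close>. In a steep square two opposite edges are thus
  parallel before normalization.\<close>

lemma hpt_edge:
  "hpt (Suc i) n k - hpt i (n + 1) k = (2 * pc i + 6 * ps i) *\<^sub>R
    comb (cos (of_int n * pi / 2) - sin (of_int n * pi / 2)) (cos (of_int n * pi / 2) + sin (of_int n * pi / 2)) 0 0"
proof -
  have n: "of_int (n + 1) * pi / 2 = of_int n * pi / 2 + pi / 2"
    by (simp add: algebra_simps add_divide_distrib)
  show ?thesis
    unfolding hpt_def comb_linear comb_eq_iff n cos_add sin_add cos_pi_half sin_pi_half
    by (simp add: pc_Suc ps_Suc algebra_simps)
qed

lemma aff_dim_steep_square: "aff_dim (steep_square e i n k) \<le> 2"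
proof -
  define \<rho> where "\<rho> = (2 * pc (Suc i) + 6 * ps (Suc i)) / (2 * pc i + 6 * ps i)"
  have pos: "2 * pc i + 6 * ps i > 0" using pc_pos[of i] ps_ge_0[of i] by linarith
  have \<rho>: "\<rho> * (2 * pc i + 6 * ps i) = 2 * pc (Suc i) + 6 * ps (Suc i)" using pos by (simp add: \<rho>_def)
  have "hpt (Suc (Suc i)) n k - hpt (Suc i) (n + 1) k = \<rho> *\<^sub>R (hpt (Suc i) n (k + e) - hpt i (n + 1) (k + e))"
    unfolding hpt_edge scaleR_scaleR \<rho> ..
  then have "hpt (Suc (Suc i)) n k = \<rho> *\<^sub>R hpt (Suc i) n (k + e) + 1 *\<^sub>R hpt (Suc i) (n + 1) k + (- \<rho>) *\<^sub>R hpt i (n + 1) (k + e)"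
    by (simp add: algebra_simps)
  moreover have "pc (Suc (Suc i)) = \<rho> * pc (Suc i) + 1 * pc (Suc i) + (- \<rho>) * pc i"
    using \<rho> by (simp add: pc_Suc ps_Suc algebra_simps)
  ultimately show ?thesis unfolding steep_square_def by (rule aff_dim_hpt_lincomb_le_2)
qed

text \<open>The base of the iterated pyramid is a face, so the dimension of its span is the same in
  every realization.\<close>

lemma base_face:
  "convex hull (pts {..N}) face_of convex hull (verts N)" "verts N \<inter> convex hull (pts {..N}) = pts {..N}"
proof -
  have "\<Sum>apexes \<bullet> x = 0" if "x \<in> pts {..N}" for x
    using that pt_inner_apex by (auto simp: pts_def inner_sum_left inner_commute intro!: sum.neutral)
  moreover have "\<Sum>apexes \<bullet> x = 1" if "x \<in> apexes" for x
  proof -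
    have "\<Sum>apexes \<bullet> x = (\<Sum>y\<in>apexes. if y = x then 1 else 0)"
      unfolding inner_sum_left using that by (intro sum.cong) (auto simp: apexes_def inner_Basis)
    then show ?thesis using that finite_apexes by simp
  qed
  ultimately have vals: "\<Sum>apexes \<bullet> x + 0 = (if x \<in> pts {..N} then 0 else 1)" if "x \<in> verts N" for x
    using that by (auto simp: verts_def)
  have nonneg: "\<Sum>apexes \<bullet> x + 0 \<ge> 0" and zero: "\<Sum>apexes \<bullet> x + 0 = 0 \<longleftrightarrow> x \<in> pts {..N}"
    if "x \<in> verts N" for x
    unfolding vals[OF that] by simp_all
  have sub: "pts {..N} \<subseteq> verts N" by (simp add: verts_def)
  show "convex hull (pts {..N}) face_of convex hull (verts N)"
    by (rule supporting_functional_face(1)[OF finite_verts nonneg zero sub])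
  show "verts N \<inter> convex hull (pts {..N}) = pts {..N}"
    by (rule supporting_functional_face(2)[OF finite_verts nonneg zero sub])
qed

lemma aff_dim_verts: "aff_dim (verts N) = int DIM('a)"
proof (rule ccontr)
  assume "aff_dim (verts N) \<noteq> int DIM('a)"
  then have "aff_dim (verts N) < int DIM('a)" using aff_dim_le_DIM[of "verts N"] by linarith
  then obtain a \<beta> where a: "a \<noteq> 0" "verts N \<subseteq> {x. a \<bullet> x = \<beta>}" by (rule aff_lowdim_subset_hyperplane)
  define y0 y1 y2 y3 where "y0 = a \<bullet> b0" and "y1 = a \<bullet> b1" and "y2 = a \<bullet> b2" and "y3 = a \<bullet> b3"
  have lin: "a \<bullet> comb x y z u = x * y0 + y * y1 + z * y2 + u * y3" for x y z u
    by (simp add: comb_def inner_add_right y0_def y1_def y2_def y3_def)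
  have "pt 0 n k \<in> verts N" if "even (n + k)" for n k
    using that by (auto simp: verts_def intro!: ptsI)
  then have "a \<bullet> hpt 0 n k = 2 * \<beta>" if "even (n + k)" for n k
    using a(2) that by (force simp: hpt_eq_pt)
  \<comment> \<open>Six points of layer 0 already annihilate the four coefficients and the constant;
    the apexes annihilate the rest.\<close>
  from this[of 0 0] this[of 0 2] this[of 0 4] this[of 2 0] this[of 1 1] this[of 3 1]
  have "y0 + sqrt 3 * y2 = 2 * \<beta>"
    "y0 + sqrt 3 * cos (2 * pi / 3) * y2 + sqrt 3 * sin (2 * pi / 3) * y3 = 2 * \<beta>"
    "y0 + sqrt 3 * cos (4 * pi / 3) * y2 + sqrt 3 * sin (4 * pi / 3) * y3 = 2 * \<beta>"
    "- y0 + sqrt 3 * y2 = 2 * \<beta>"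
    "y1 + sqrt 3 * cos (pi / 3) * y2 + sqrt 3 * sin (pi / 3) * y3 = 2 * \<beta>"
    "- y1 + sqrt 3 * cos (pi / 3) * y2 + sqrt 3 * sin (pi / 3) * y3 = 2 * \<beta>"
    using cos_sin_quarter_int[of 1] cos_sin_quarter_int[of 2] cos_sin_quarter_int[of 3]
    by (simp_all add: hpt_def lin)
  moreover have "cos (2 * pi / 3) = - 1 / 2" "cos (4 * pi / 3) = - 1 / 2"
    using cos_third_int[of 2] cos_third_int[of 4] by simp_all
  moreover have "sin (2 * pi / 3) = sqrt 3 / 2" "sin (4 * pi / 3) = - sqrt 3 / 2"
  proof -
    have "2 * pi / 3 = pi - pi / 3" "4 * pi / 3 = pi / 3 + pi" by simp_all
    then show "sin (2 * pi / 3) = sqrt 3 / 2" "sin (4 * pi / 3) = - sqrt 3 / 2"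
      by (simp_all only: sin_diff sin_add sin_60 cos_60) simp_all
  qed
  ultimately have y: "y0 + sqrt 3 * y2 = 2 * \<beta>" "y0 - sqrt 3 * y2 / 2 + 3 / 2 * y3 = 2 * \<beta>"
    "y0 - sqrt 3 * y2 / 2 - 3 / 2 * y3 = 2 * \<beta>" "- y0 + sqrt 3 * y2 = 2 * \<beta>"
    "y1 + sqrt 3 * y2 / 2 + 3 / 2 * y3 = 2 * \<beta>" "- y1 + sqrt 3 * y2 / 2 + 3 / 2 * y3 = 2 * \<beta>"
    by (simp_all add: cos_60 sin_60)
  have "y0 = 0" "y3 = 0" "sqrt 3 * y2 = 0" "\<beta> = 0" "y1 = 0" using y by linarith+
  then have "a \<bullet> b = 0" if "b \<in> {b0, b1, b2, b3}" for b
    using that by (auto simp: y0_def y1_def y2_def y3_def)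
  moreover have "a \<bullet> b = 0" if "b \<in> apexes" for b
    using that a(2) \<open>\<beta> = 0\<close> by (auto simp: verts_def)
  ultimately have "a \<bullet> b = 0" if "b \<in> Basis" for b using that by (auto simp: apexes_def)
  then show False using a(1) euclidean_all_zero_iff by blast
qed

text \<open>The lower bound comes from above: adjoining \<open>DIM('a) - 4\<close> apexes gives full
  dimension, and each apex contributes at most one.\<close>

lemma aff_dim_pts: "aff_dim (pts {..N}) = 4"
proof (rule antisym)
  have "int DIM('a) \<le> aff_dim (pts {..N}) + int (card apexes)"
    using aff_dim_Un_finite_le[OF finite_apexes, of "pts {..N}"] aff_dim_verts[of N] by (simp add: verts_def)
  then show "aff_dim (pts {..N}) \<ge> 4" using card_apexes DIM_ge_4 by simp
  have "comb p q r s \<in> span {b0, b1, b2, b3}" for p q r s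
    unfolding comb_def by (intro span_add span_scale span_base) auto
  then have "pts {..N} \<subseteq> span {b0, b1, b2, b3}"
    by (auto simp: pts_def pt_def hpt_def intro!: span_scale)
  then have "aff_dim (pts {..N}) \<le> aff_dim (span {b0, b1, b2, b3})" by (rule aff_dim_subset)
  also have "\<dots> = int (dim {b0, b1, b2, b3})" by (simp add: aff_dim_subspace)
  also have "dim {b0, b1, b2, b3} \<le> card {b0, b1, b2, b3}" by (intro dim_le_card') auto
  also have "card {b0, b1, b2, b3} \<le> 4" by (simp add: card_insert_if)
  finally show "aff_dim (pts {..N}) \<le> 4" by simp
qed

lemma vertices_hull: "vertices (convex hull (verts N)) = verts N"
  by (rule vertices_convex_hull_sphere[OF verts_sphere])

lemma polytope_hull: "polytope (convex hull (verts N))"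
  by (simp add: polytope_convex_hull finite_verts)

section \<open>Recovering a realization from its two lowest layers\<close>

lemma corner_distinct:
  "distinct [pt (Suc (Suc i)) n k, pt (Suc i) n (k + (- 1)), pt (Suc i) n (k + 1), pt (Suc i) (n + 1) k,
    pt i n k, pt i (n + 1) (k + (- 1)), pt i (n + 1) (k + 1)]"
proof -
  have "n mod 4 \<noteq> (n + 1) mod 4" "(k + (- 1)) mod 6 \<noteq> (k + 1) mod 6" by presburger+
  then show ?thesis by (simp add: pt_eq_iff)
qed

lemma pts_induct [consumes 1, case_names seed step]:
  assumes "x \<in> pts {..N}"
    and seed: "\<And>x. x \<in> pts {..1} \<Longrightarrow> Q x"
    and step: "\<And>i n k. Suc (Suc i) \<le> N \<Longrightarrow> even (int i + n + k) \<Longrightarrow>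
      (\<And>j m l. j < Suc (Suc i) \<Longrightarrow> even (int j + m + l) \<Longrightarrow> Q (pt j m l)) \<Longrightarrow> Q (pt (Suc (Suc i)) n k)"
  shows "Q x"
proof -
  have "Q (pt i n k)" if "i \<le> N" "even (int i + n + k)" for i n k
    using that
  proof (induction i arbitrary: n k rule: less_induct)
    case (less i)
    show ?case
    proof (cases "i \<le> 1")
      case True
      then show ?thesis using less.prems by (intro seed ptsI) auto
    next
      case False
      then obtain j where j: "i = Suc (Suc j)" by (metis One_nat_def not0_implies_Suc not_less_eq_eq zero_le)
      show ?thesis unfolding j
        using less j by (intro step less.IH) auto
    qed
  qed
  then show ?thesis using assms(1) unfolding pts_def by blast
qed

text \<open>The top vertex of a flat square lies in the span of the three lower ones, so spans do
  not grow with the layers. Together with \<open>base_face\<close> this gives the seeds rank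
  5.\<close>

lemma realization_seed_span:
  assumes V: "V \<in> realization_space (convex hull (verts N))" and "x \<in> pts {..N}"
  shows "V x \<in> span (V ` pts {..1})"
  using assms(2)
proof (induction rule: pts_induct)
  case (seed x)
  then show ?case by (intro span_base) auto
next
  case (step i n k)
  let ?w = "pt (Suc (Suc i)) n k" and ?u1 = "pt (Suc i) n (k + (- 1))" and ?u2 = "pt (Suc i) n (k + 1)"
    and ?z = "pt i n k"
  have "V ?w \<in> span {V ?u1, V ?u2, V ?z}"
  proof (rule realization_square_span[OF polytope_hull V flat_square_face(1)[OF step(1,2)]])
    show "vertices (convex hull (verts N)) \<inter> convex hull flat_square i n k = {?w, ?u1, ?u2, ?z}"
      unfolding vertices_hull flat_square_face(2)[OF step(1,2)] by (simp add: flat_square_def)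
    show "aff_dim (convex hull flat_square i n k) \<le> 2" by (simp add: aff_dim_convex_hull aff_dim_flat_square)
  qed (use corner_distinct[of i n k] in auto)
  moreover have par: "even (int (Suc i) + n + (k + (- 1)))" "even (int (Suc i) + n + (k + 1))"
    using step(2) by presburger+
  have "{V ?u1, V ?u2, V ?z} \<subseteq> span (V ` pts {..1})"
    using step(3)[OF _ par(1)] step(3)[OF _ par(2)] step(3)[OF _ step(2)] by simp
  then have "span {V ?u1, V ?u2, V ?z} \<subseteq> span (V ` pts {..1})" by (intro span_minimal) auto
  ultimately show ?case by blast
qed

text \<open>Each vertex from layer 2 on is the top of one flat and two steep squares, whose other
  vertices lie in the two preceding layers.\<close>

lemma realization_determined:
  assumes V: "V \<in> realization_space (convex hull (verts N))" and V': "V' \<in> realization_space (convex hull (verts N))"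
    and agree: "\<forall>v\<in>pts {..1} \<union> apexes. V v = V' v" and sign: "\<forall>v\<in>verts N. V' v \<noteq> - V v"
  shows "V = V'"
proof -
  let ?P = "convex hull (verts N)"
  have unit: "norm (U v) = 1" if "U \<in> realization_space ?P" "v \<in> verts N" for U v
    using that by (auto simp: realization_space_def vertices_hull PiE_iff)
  have "V' x = V x" if "x \<in> pts {..N}" for x
    using that
  proof (induction rule: pts_induct)
    case (seed x)
    then show ?case using agree by simp
  next
    case (step i n k)
    let ?w = "pt (Suc (Suc i)) n k"
    have par: "even (int (Suc i) + n + (k + (- 1)))" "even (int (Suc i) + n + (k + 1))"
      "even (int (Suc i) + (n + 1) + k)" "even (int i + (n + 1) + (k + (- 1)))" "even (int i + (n + 1) + (k + 1))"
      using step(2) by presburger+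
    have w: "?w \<in> verts N" unfolding verts_def using step(1,2) by (intro UnI1 ptsI) auto
    have "V' ?w \<in> span {V ?w}"
    proof (rule realization_corner_determined[OF polytope_hull V V' flat_square_face(1)[OF step(1,2)] _ _
          steep_square_face(1)[OF step(1,2), of "- 1"] _ _ steep_square_face(1)[OF step(1,2), of 1]])
      show "vertices ?P \<inter> convex hull flat_square i n k =
          {?w, pt (Suc i) n (k + (- 1)), pt (Suc i) n (k + 1), pt i n k}"
        unfolding vertices_hull flat_square_face(2)[OF step(1,2)] by (simp add: flat_square_def)
      show "vertices ?P \<inter> convex hull steep_square (- 1) i n k =
          {?w, pt (Suc i) n (k + (- 1)), pt (Suc i) (n + 1) k, pt i (n + 1) (k + (- 1))}"
        unfolding vertices_hull by (subst steep_square_face(2)[OF step(1,2)]) (simp_all add: steep_square_def)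
      show "vertices ?P \<inter> convex hull steep_square 1 i n k =
          {?w, pt (Suc i) n (k + 1), pt (Suc i) (n + 1) k, pt i (n + 1) (k + 1)}"
        unfolding vertices_hull by (subst steep_square_face(2)[OF step(1,2)]) (simp_all add: steep_square_def)
      show "V' v = V v" if "v \<in> {pt (Suc i) n (k + (- 1)), pt (Suc i) n (k + 1), pt (Suc i) (n + 1) k,
          pt i n k, pt i (n + 1) (k + (- 1)), pt i (n + 1) (k + 1)}" for v
        using that step(3)[OF _ par(1)] step(3)[OF _ par(2)] step(3)[OF _ par(3)] step(3)[OF _ par(4)]
          step(3)[OF _ par(5)] step(3)[OF _ step(2)] by (elim insertE emptyE) simp_all
      show "distinct [?w, pt (Suc i) n (k + (- 1)), pt (Suc i) n (k + 1), pt (Suc i) (n + 1) k,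
          pt i n k, pt i (n + 1) (k + (- 1)), pt i (n + 1) (k + 1)]" by (rule corner_distinct)
    qed (simp_all add: aff_dim_convex_hull aff_dim_flat_square aff_dim_steep_square)
    \<comment> \<open>Unit length leaves a sign, which the assumption on antipodes settles.\<close>
    then obtain c where c: "V' ?w = c *\<^sub>R V ?w" by (auto simp: span_singleton)
    then have "\<bar>c\<bar> = 1" using unit[OF V w] unit[OF V' w] by simp
    moreover have "c \<noteq> - 1" using c sign w by auto
    ultimately show ?case using c by (auto simp: abs_if split: if_splits)
  qed
  then have "V x = V' x" if "x \<in> verts N" for x using that agree by (auto simp: verts_def)
  moreover have "V \<in> extensional (verts N)" "V' \<in> extensional (verts N)"
    using V V' by (auto simp: realization_space_def vertices_hull PiE_iff)
  ultimately show ?thesis by (intro extensionalityI[of V "verts N" V']) auto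
qed

text \<open>For \<open>N \<ge> 1\<close> both seed layers belong to the polytope. They form the
  family of rank 5 in the chart count, and the apexes are its unconstrained vectors.\<close>

lemma dim_RS_hull:
  assumes "N \<ge> 1"
  shows "dim_RS (convex hull (verts N)) \<le> ereal (real (76 + DIM('a) * (DIM('a) + 1)))"
proof -
  let ?P = "convex hull (verts N)"
  have sub: "pts {..1} \<subseteq> pts {..N}" using assms unfolding pts_def by fastforce
  have "semialgebraic_dim (verts N \<times> Basis) (tuple_coords (verts N) ` realization_space ?P) \<le>
    ereal (real (5 * (DIM('a \<times> real) - 1) + (card (pts {..1}) - 5) * (5 - 1) + card apexes * (DIM('a \<times> real) - 1)))"
  proof (rule configuration_space_dim_le)
    show "finite (verts N)" by (rule finite_verts)
    show "pts {..1} \<subseteq> verts N" "apexes \<subseteq> verts N" using sub by (auto simp: verts_def)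
    show "pts {..1} \<inter> apexes = {}" by (rule pts_Int_apexes)
    show "norm (V v) = 1" if "V \<in> realization_space ?P" "v \<in> verts N" for V v
      using that by (auto simp: realization_space_def vertices_hull PiE_iff)
    show "dim (V ` pts {..1}) = 5" if V: "V \<in> realization_space ?P" for V
    proof -
      have "V ` pts {..N} \<subseteq> span (V ` pts {..1})" using realization_seed_span[OF V] by auto
      then have "span (V ` pts {..N}) = span (V ` pts {..1})"
        using sub by (intro subset_antisym span_minimal span_mono) auto
      then have "dim (V ` pts {..1}) = dim (V ` pts {..N})" by (metis dim_span)
      also have "int (dim (V ` pts {..N})) = 5"
        using realization_space_span(1)[OF polytope_hull V base_face(1)]
        by (simp add: vertices_hull base_face(2) aff_dim_convex_hull aff_dim_pts)
      finally show ?thesis by simp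
    qed
  qed (use realization_determined in blast)
  also have "5 * (DIM('a \<times> real) - 1) + (card (pts {..1}) - 5) * (5 - 1) + card apexes * (DIM('a \<times> real) - 1)
      = 76 + DIM('a) * (DIM('a) + 1)"
  proof -
    obtain m where "DIM('a) = m + 4" using DIM_ge_4 by (metis add.commute le_Suc_ex)
    then show ?thesis by (simp add: card_pts card_apexes algebra_simps)
  qed
  finally show ?thesis by (simp add: dim_RS_def vertices_hull)
qed

end

lemma four_basis_vectors_exist:
  assumes "DIM('a::euclidean_space) \<ge> 4"
  obtains b0 b1 b2 b3 :: "'a::euclidean_space" where "four_basis_vectors b0 b1 b2 b3"
proof -
  obtain B :: "'a set" where B: "B \<subseteq> Basis" "card B = 4" using assms by (meson obtain_subset_with_card_n)
  then obtain xs where xs: "set xs = B" "distinct xs" "length xs = 4"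
    by (metis card_gt_0_iff distinct_card finite_distinct_list zero_less_numeral)
  then obtain b0 b1 b2 b3 where "xs = [b0, b1, b2, b3]"
    by (auto simp: numeral_eq_Suc length_Suc_conv)
  then show thesis using that[of b0 b1 b2 b3] xs B by (auto simp: four_basis_vectors_def)
qed

theorem theoremA32:
  fixes d :: nat
  assumes "d \<ge> 4" and "CARD('n::finite) = d"
  shows "\<exists>P :: nat \<Rightarrow> (real ^ 'n) set.
           (\<forall>n\<ge>1. polytope (P n) \<and> aff_dim (P n) = int d \<and> inscribed (P n) \<and>
                   card (vertices (P n)) = 12 * (n + 1) + d - 4 \<and>
                   dim_RS (P n) \<le> ereal (real (76 + d * (d + 1)))) \<and>
           (\<forall>m\<ge>1. \<forall>n\<ge>1. m \<noteq> n \<longrightarrow> \<not> comb_equiv (P m) (P n))"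
proof -
  have d: "DIM(real ^ 'n) = d" using assms by simp
  obtain b0 b1 b2 b3 :: "real ^ 'n" where "four_basis_vectors b0 b1 b2 b3"
    using four_basis_vectors_exist d assms(1) by metis
  then interpret four_basis_vectors b0 b1 b2 b3 .
  let ?P = "\<lambda>n. convex hull (verts n)"
  have card: "card (vertices (?P n)) = 12 * (n + 1) + d - 4" for n
    unfolding vertices_hull card_verts d ..
  have "polytope (?P n) \<and> aff_dim (?P n) = int d \<and> inscribed (?P n) \<and>
      card (vertices (?P n)) = 12 * (n + 1) + d - 4 \<and> dim_RS (?P n) \<le> ereal (real (76 + d * (d + 1)))"
    if "n \<ge> 1" for n
  proof (intro conjI card)
    show "polytope (?P n)" by (rule polytope_hull)
    show "aff_dim (?P n) = int d" unfolding aff_dim_convex_hull aff_dim_verts d ..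
    show "inscribed (?P n)"
      unfolding inscribed_def vertices_hull using verts_sphere[of n] by (intro exI[of _ 0] exI[of _ 1]) simp
    show "dim_RS (?P n) \<le> ereal (real (76 + d * (d + 1)))" using dim_RS_hull[OF that] unfolding d .
  qed
  \<comment> \<open>The vertex numbers already differ.\<close>
  moreover have "\<not> comb_equiv (?P m) (?P n)" if "m \<noteq> n" for m n
    using comb_equiv_card_vertices[OF polytope_hull polytope_hull] card[of m] card[of n] that assms(1) by fastforce
  ultimately show ?thesis by (intro exI[of _ ?P]) blast
qed

end
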